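(* Let $G=(V,A)$ be a swap digraph (a strongly connected digraph without self-loops or parallel arcs). Then $G$ has an atomic HTLC-based protocol if and only if $G$ is a reuniclus digraph.
   Context: Swap model: vertices of $G$ are parties; each arc $(u,v)$ is an asset of $u$ (seller) to be transferred to $v$ (buyer). Time is discrete, steps $0,1,2,\dots$. Each party $v$ may create one secret $s_v$ and hashlock $h_v=H(s_v)$, $H$ a one-way permutation (no one else can compute $s_v$ from $h_v$). An HTLC (hash time-lock contract) on arc $(u,v)$ is created by $u$ with the asset, a timeout $\tau$ and a hashlock $h$ (the hashlock $h_x$ of some party $x$ that created a pair; the contract is then "protected by $x$"); the asset goes into escrow; if $v$ supplies $s$ with $H(s)=h$ no later than time $\tau$, the asset goes to $v$ and $u$ learns $s$; otherwise after time $\tau$ it returns to $u$. Each contract can be created only once. An HTLC-based protocol is one in which at each step each party may perform any number of these actions (create its secret/hashlock pair, create an outgoing contract, claim an incoming asset whose protecting secret it knows), with all transfers done by HTLCs; parties can read their incoming contracts (including hashlocks), may distribute hashlock values, and cannot break the cryptography. An honest (conforming) party follows the protocol until it infers from an interaction that not all parties follow it; afterwards it may act arbitrarily but rationally. Outcomes: an outcome of party $v$ is a pair $(I,O)$ with $I$ the set of incoming arcs of $v$ whose assets $v$ acquired and $O$ the set of outgoing arcs whose assets $v$ relinquished; it is acceptable if $I$ is all incoming arcs of $v$ or $O=\emptyset$. Deal = all incoming acquired and all outgoing relinquished; NoDeal $=(\emptyset,\emptyset)$; Discount = all incoming acquired, not all outgoing relinquished; FreeRide = $O=\emptyset$, $I\neq\emptyset$;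 all other outcomes are Underwater. For a set $C$ of parties, incoming/outgoing arcs are those entering/leaving $C$, and outcomes/acceptability are defined analogously. Each party has a preference relation, a partial order on its outcomes such that (p1) $(I_2,O_2)$ is preferred to $(I_1,O_1)$ whenever $I_1\subseteq I_2$ and $O_1\supseteq O_2$; (p2) NoDeal is preferred to every Underwater outcome; (p3) Deal is preferred to NoDeal. A protocol is live if, when all parties follow it, every party ends in Deal; safe if every honest party ends in an acceptable outcome regardless of others' behavior; has the strong Nash equilibrium property if for every coalition $C$, when all parties outside $C$ follow the protocol, the parties of $C$ cannot improve the outcome of $C$ by deviating; atomic if live, safe and strong Nash. Graphs: a bottleneck digraph is a strongly connected digraph having a vertex (a bottleneck) that lies on every cycle. A reuniclus digraph is a strongly connected digraph $G$ for which there are vertices $b_1,\dots,b_p$, subgraphs $G_1,\dots,G_p$, and a rooted tree $\mathcal K$ on $\{b_1,\dots,b_p\}$ such that: (rg1) each $G_j$ is an induced subgraph of $G$ that is a bottleneck digraph with bottleneck $b_j$, and each arc of $G$ belongs to exactly one $G_j$; (rg2) each vertex of $G$ other than the non-root $b_j$'s belongs to exactly one $G_j$, while each non-root $b_j$ belongs to exactly $G_j$ and $G_i$ where $b_i$ is the parent of $b_j$ in $\mathcal K$ (so the bottleneck of each non-root component is an articulation vertex lying in its parent component). *)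

theory Defs
  imports "Graph_Theory.Graph_Theory"
begin

section \<open>Digraphs\<close>

definition swap_digraph :: "('a, 'b) pre_digraph \<Rightarrow> bool" where
  "swap_digraph G \<longleftrightarrow> digraph G \<and> strongly_connected G"

definition bottleneck_digraph :: "('a, 'b) pre_digraph \<Rightarrow> 'a \<Rightarrow> bool" where
  "bottleneck_digraph H b \<longleftrightarrow>
     strongly_connected H \<and> b \<in> verts H \<and>
     (\<forall>p. pre_digraph.cycle H p \<longrightarrow> b \<in> tail H ` set p)"

text \<open>Rooted trees on \<open>B\<close> with root \<open>r\<close>, given by the parent of each non-root vertex.\<close>

definition rooted_tree :: "'a set \<Rightarrow> 'a \<Rightarrow> ('a \<Rightarrow> 'a) \<Rightarrow> bool" where
  "rooted_tree B r parent \<longleftrightarrow>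
     finite B \<and> r \<in> B \<and> (\<forall>b\<in>B - {r}. parent b \<in> B) \<and>
     (\<forall>b\<in>B. (b, r) \<in> {(c, parent c) | c. c \<in> B - {r}}\<^sup>*)"

text \<open>The components \<open>G\<^sub>j\<close> are indexed by their bottlenecks \<open>b\<^sub>j\<close>: \<open>K b\<close> is the component
  with bottleneck \<open>b\<close>.\<close>

definition reuniclus :: "('a, 'b) pre_digraph \<Rightarrow> bool" where
  "reuniclus G \<longleftrightarrow> strongly_connected G \<and>
     (\<exists>B r parent K. B \<subseteq> verts G \<and> rooted_tree B r parent \<and>
        (\<forall>b\<in>B. induced_subgraph (K b) G \<and> bottleneck_digraph (K b) b) \<and>
        (\<forall>e\<in>arcs G. \<exists>!b. b \<in> B \<and> e \<in> arcs (K b)) \<and>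
        (\<forall>v\<in>verts G - (B - {r}). \<exists>!b. b \<in> B \<and> v \<in> verts (K b)) \<and>
        (\<forall>b\<in>B - {r}. {c \<in> B. b \<in> verts (K c)} = {b, parent b}))"


section \<open>Hash time-lock contracts\<close>

text \<open>
  Cryptography is symbolic: each party owns at most one secret/hashlock pair, so both the
  secret \<open>s\<^sub>x\<close> and the hashlock \<open>h\<^sub>x\<close> are named by \<open>x\<close>, and one-wayness is expressed by the
  knowledge sets \<open>known_secrets\<close> and \<open>known_hashes\<close> below.

  A move collects everything a party does in one step. \<open>create e = Some (\<tau>, x)\<close> creates
  the contract on the outgoing arc \<open>e\<close> with timeout \<open>\<tau>\<close> and hashlock \<open>h\<^sub>x\<close>; a pair \<open>(w, x)\<close> in
  \<open>send_hash\<close> (\<open>send_secret\<close>) sends \<open>h\<^sub>x\<close> (\<open>s\<^sub>x\<close>) to \<open>w\<close>. Sending secrets is not part of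
  HTLC-based protocols, see \<open>htlc_based\<close>; it is what deviating parties may do in order to collude.
\<close>

record ('a, 'b) move =
  new_pair :: bool
  create :: "'b \<Rightarrow> (nat \<times> 'a) option"
  claim :: "'b set"
  send_hash :: "('a \<times> 'a) set"
  send_secret :: "('a \<times> 'a) set"

text \<open>\<open>paired\<close> is the set of parties that have created their pair. Messages are triples
  (sender, recipient, owner of the hashlock or secret). A contract on \<open>e\<close> that is not in
  \<open>claimed\<close> when its timeout has passed can no longer be claimed, i.e. the asset is refunded.\<close>

record ('a, 'b) state =
  paired :: "'a set"
  contract :: "'b \<Rightarrow> (nat \<times> 'a) option"
  claimed :: "'b set"
  hash_msgs :: "('a \<times> 'a \<times> 'a) set"
  secret_msgs :: "('a \<times> 'a \<times> 'a) set"

definition init_state :: "('a, 'b) state" where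
  "init_state = \<lparr>paired = {}, contract = Map.empty, claimed = {}, hash_msgs = {}, secret_msgs = {}\<rparr>"

definition known_secrets :: "('a, 'b) pre_digraph \<Rightarrow> ('a, 'b) state \<Rightarrow> 'a \<Rightarrow> 'a set" where
  "known_secrets G s v =
     (paired s \<inter> {v}) \<union>
     {x. \<exists>e \<tau>. e \<in> out_arcs G v \<and> e \<in> claimed s \<and> contract s e = Some (\<tau>, x)} \<union>
     {x. \<exists>u. (u, v, x) \<in> secret_msgs s}"

definition known_hashes :: "('a, 'b) pre_digraph \<Rightarrow> ('a, 'b) state \<Rightarrow> 'a \<Rightarrow> 'a set" where
  "known_hashes G s v =
     known_secrets G s v \<union>
     {x. \<exists>e \<tau>. e \<in> in_arcs G v \<and> contract s e = Some (\<tau>, x)} \<union>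
     {x. \<exists>u. (u, v, x) \<in> hash_msgs s}"

text \<open>Simultaneous execution of the moves \<open>m v\<close> of all parties \<open>v\<close> at time \<open>t\<close>; actions that are
  not possible have no effect. Actions of others become visible, and secrets become known, at the
  next step; a party's own new pair can be used immediately.\<close>

definition step ::
  "('a, 'b) pre_digraph \<Rightarrow> nat \<Rightarrow> ('a \<Rightarrow> ('a, 'b) move) \<Rightarrow> ('a, 'b) state \<Rightarrow> ('a, 'b) state" where
  "step G t m s0 =
     (let s = s0\<lparr>paired := paired s0 \<union> {v \<in> verts G. new_pair (m v)}\<rparr> in
      s\<lparr>contract := (\<lambda>e. case contract s e of
            Some c \<Rightarrow> Some c
          | None \<Rightarrow>
              (case create (m (tail G e)) e of
                 Some (\<tau>, x) \<Rightarrow>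
                   if e \<in> arcs G \<and> x \<in> known_hashes G s (tail G e) then Some (\<tau>, x) else None
               | None \<Rightarrow> None)),
        claimed := claimed s \<union>
          {e \<in> arcs G. e \<in> claim (m (head G e)) \<and>
             (\<exists>\<tau> x. contract s e = Some (\<tau>, x) \<and> t \<le> \<tau> \<and> x \<in> known_secrets G s (head G e))},
        hash_msgs := hash_msgs s \<union>
          {(v, w, x). v \<in> verts G \<and> w \<in> verts G \<and> (w, x) \<in> send_hash (m v) \<and>
             x \<in> known_hashes G s v},
        secret_msgs := secret_msgs s \<union>
          {(v, w, x). v \<in> verts G \<and> w \<in> verts G \<and> (w, x) \<in> send_secret (m v) \<and>
             x \<in> known_secrets G s v}\<rparr>)"

text \<open>The part of the state that party \<open>v\<close> can observe.\<close>

definition view :: "('a, 'b) pre_digraph \<Rightarrow> 'a \<Rightarrow> ('a, 'b) state \<Rightarrow> ('a, 'b) state" where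
  "view G v s =
     \<lparr>paired = paired s \<inter> {v},
      contract = contract s |` (in_arcs G v \<union> out_arcs G v),
      claimed = claimed s \<inter> (in_arcs G v \<union> out_arcs G v),
      hash_msgs = {(u, w, x) \<in> hash_msgs s. u = v \<or> w = v},
      secret_msgs = {(u, w, x) \<in> secret_msgs s. u = v \<or> w = v}\<rparr>"

text \<open>A strategy maps the list of views at times \<open>0, \<dots>, t\<close> to the move at time \<open>t\<close>. Hence a
  protocol, i.e. a strategy for each party, also fixes how its parties continue once
  they have observed that someone deviates.\<close>

type_synonym ('a, 'b) strategy = "('a, 'b) state list \<Rightarrow> ('a, 'b) move"

primrec history ::
  "('a, 'b) pre_digraph \<Rightarrow> ('a \<Rightarrow> ('a, 'b) strategy) \<Rightarrow> nat \<Rightarrow> ('a, 'b) state list" where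
  "history G \<sigma> 0 = [init_state]"
| "history G \<sigma> (Suc t) =
     history G \<sigma> t @
       [step G t (\<lambda>v. \<sigma> v (map (view G v) (history G \<sigma> t))) (last (history G \<sigma> t))]"

definition transferred :: "('a, 'b) pre_digraph \<Rightarrow> ('a \<Rightarrow> ('a, 'b) strategy) \<Rightarrow> 'b set" where
  "transferred G \<sigma> = (\<Union>t. claimed (last (history G \<sigma> t)))"

definition htlc_based :: "('a, 'b) pre_digraph \<Rightarrow> ('a \<Rightarrow> ('a, 'b) strategy) \<Rightarrow> bool" where
  "htlc_based G P \<longleftrightarrow> (\<forall>v\<in>verts G. \<forall>h. send_secret (P v h) = {})"


section \<open>Outcomes and preferences\<close>

text \<open>Everything is defined for a set \<open>C\<close> of parties; a single party \<open>v\<close> is the case \<open>C = {v}\<close>.\<close>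

type_synonym 'b outcome = "'b set \<times> 'b set"

definition incoming :: "('a, 'b) pre_digraph \<Rightarrow> 'a set \<Rightarrow> 'b set" where
  "incoming G C = {e \<in> arcs G. tail G e \<notin> C \<and> head G e \<in> C}"

definition outgoing :: "('a, 'b) pre_digraph \<Rightarrow> 'a set \<Rightarrow> 'b set" where
  "outgoing G C = {e \<in> arcs G. tail G e \<in> C \<and> head G e \<notin> C}"

definition outcomes :: "('a, 'b) pre_digraph \<Rightarrow> 'a set \<Rightarrow> 'b outcome set" where
  "outcomes G C = Pow (incoming G C) \<times> Pow (outgoing G C)"

definition acceptable :: "('a, 'b) pre_digraph \<Rightarrow> 'a set \<Rightarrow> 'b outcome \<Rightarrow> bool" where
  "acceptable G C \<omega> \<longleftrightarrow> fst \<omega> = incoming G C \<or> snd \<omega> = {}"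

definition deal :: "('a, 'b) pre_digraph \<Rightarrow> 'a set \<Rightarrow> 'b outcome" where
  "deal G C = (incoming G C, outgoing G C)"

definition no_deal :: "'b outcome" where
  "no_deal = ({}, {})"

definition discount :: "('a, 'b) pre_digraph \<Rightarrow> 'a set \<Rightarrow> 'b outcome \<Rightarrow> bool" where
  "discount G C \<omega> \<longleftrightarrow> fst \<omega> = incoming G C \<and> snd \<omega> \<noteq> outgoing G C"

definition free_ride :: "'b outcome \<Rightarrow> bool" where
  "free_ride \<omega> \<longleftrightarrow> fst \<omega> \<noteq> {} \<and> snd \<omega> = {}"

definition underwater :: "('a, 'b) pre_digraph \<Rightarrow> 'a set \<Rightarrow> 'b outcome \<Rightarrow> bool" where
  "underwater G C \<omega> \<longleftrightarrow>
     \<omega> \<noteq> deal G C \<and> \<omega> \<noteq> no_deal \<and> \<not> discount G C \<omega> \<and> \<not> free_ride \<omega>"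

text \<open>\<open>(\<omega>\<^sub>1, \<omega>\<^sub>2) \<in> R\<close> means that \<open>\<omega>\<^sub>2\<close> is preferred to \<open>\<omega>\<^sub>1\<close>.\<close>

definition preference_relation ::
  "('a, 'b) pre_digraph \<Rightarrow> 'a set \<Rightarrow> 'b outcome rel \<Rightarrow> bool" where
  "preference_relation G C R \<longleftrightarrow>
     partial_order_on (outcomes G C) R \<and>
     (\<forall>\<omega>\<^sub>1\<in>outcomes G C. \<forall>\<omega>\<^sub>2\<in>outcomes G C.
        fst \<omega>\<^sub>1 \<subseteq> fst \<omega>\<^sub>2 \<and> snd \<omega>\<^sub>1 \<supseteq> snd \<omega>\<^sub>2 \<longrightarrow> (\<omega>\<^sub>1, \<omega>\<^sub>2) \<in> R) \<and>
     (\<forall>\<omega>\<in>outcomes G C. underwater G C \<omega> \<longrightarrow> (\<omega>, no_deal) \<in> R) \<and>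
     (no_deal, deal G C) \<in> R"

definition outcome ::
  "('a, 'b) pre_digraph \<Rightarrow> ('a \<Rightarrow> ('a, 'b) strategy) \<Rightarrow> 'a set \<Rightarrow> 'b outcome" where
  "outcome G \<sigma> C = (incoming G C \<inter> transferred G \<sigma>, outgoing G C \<inter> transferred G \<sigma>)"


section \<open>Atomic protocols\<close>

definition live :: "('a, 'b) pre_digraph \<Rightarrow> ('a \<Rightarrow> ('a, 'b) strategy) \<Rightarrow> bool" where
  "live G P \<longleftrightarrow> (\<forall>v\<in>verts G. outcome G P {v} = deal G {v})"

definition safe :: "('a, 'b) pre_digraph \<Rightarrow> ('a \<Rightarrow> ('a, 'b) strategy) \<Rightarrow> bool" where
  "safe G P \<longleftrightarrow>
     (\<forall>v\<in>verts G. \<forall>\<sigma>. \<sigma> v = P v \<longrightarrow> acceptable G {v} (outcome G \<sigma> {v}))"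

definition strong_nash ::
  "('a, 'b) pre_digraph \<Rightarrow> ('a set \<Rightarrow> 'b outcome rel) \<Rightarrow> ('a \<Rightarrow> ('a, 'b) strategy) \<Rightarrow> bool" where
  "strong_nash G pref P \<longleftrightarrow>
     (\<forall>C \<sigma>. C \<subseteq> verts G \<and> C \<noteq> {} \<and> (\<forall>v\<in>verts G - C. \<sigma> v = P v) \<longrightarrow>
        \<not> (outcome G \<sigma> C \<noteq> outcome G P C \<and> (outcome G P C, outcome G \<sigma> C) \<in> pref C))"

definition atomic ::
  "('a, 'b) pre_digraph \<Rightarrow> ('a set \<Rightarrow> 'b outcome rel) \<Rightarrow> ('a \<Rightarrow> ('a, 'b) strategy) \<Rightarrow> bool" where
  "atomic G pref P \<longleftrightarrow> live G P \<and> safe G P \<and> strong_nash G pref P"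

end

theory Submission
  imports Defs
begin

text \<open>
  Safety of the honest parties already implies the strong Nash property: an honest party that loses an
  asset acquires all its incoming assets, and by strong connectivity this propagates backwards
  through the honest parties, so that a coalition ends neither in FreeRide nor in Discount. It
  remains to characterize the digraphs with a live and safe protocol.

  In a run of such a protocol where everybody is honest, all contracts exist before the first claim.
  Hence an outgoing contract of \<open>v\<close> with a foreign hashlock \<open>h\<^sub>x\<close> is created only after all incoming
  contracts of \<open>v\<close>, and these are protected by \<open>v\<close> or \<open>x\<close>: the others could claim the outgoing asset at
  once. Conversely, a contract claimed with a foreign secret requires an outgoing contract with the
  same hashlock. These two conditions on protectors and creation times (a lock schedule) force
  the arcs protected by \<open>x\<close> to form a bottleneck digraph with bottleneck \<open>x\<close>, and the creation times turn
  the foreign protector of a party into its parent in a tree. From a reuniclus digraph, a lock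
  schedule is obtained by ranking the arcs, and a lock schedule can be executed as a protocol, with
  timeouts in reverse order of creation.
\<close>

section \<open>Lock schedules\<close>

text \<open>The contract on \<open>e\<close> is protected by \<open>lk e\<close> and created at time \<open>k e\<close>.\<close>

locale lock_schedule = digraph G
  for G :: "('a, 'b) pre_digraph" +
  fixes lk :: "'b \<Rightarrow> 'a" and k :: "'b \<Rightarrow> nat"
  assumes strong: "strongly_connected G"
    and relay: "\<And>e. e \<in> arcs G \<Longrightarrow> lk e \<noteq> head G e \<Longrightarrow>
      \<exists>f\<in>arcs G. tail G f = head G e \<and> lk f = lk e"
    and order: "\<And>e f. e \<in> arcs G \<Longrightarrow> f \<in> arcs G \<Longrightarrow> head G f = tail G e \<Longrightarrow> lk e \<noteq> tail G e \<Longrightarrow>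
      k f < k e \<and> lk f \<in> {tail G e, lk e}"
begin

text \<open>Apply \<open>relay\<close> repeatedly: while the head is not the protector, some arc
  leaving it has the same protector, and by \<open>order\<close> it is created strictly later.
  Creation times are bounded, so this ends, and it can only end at the protector.\<close>

lemma walk_to_lock:
  assumes "e \<in> arcs G"
  shows "\<exists>f\<in>arcs G. lk f = lk e \<and> head G f = lk e \<and> k e \<le> k f"
  using assms
proof (induction "Max (k ` arcs G) - k e" arbitrary: e rule: less_induct)
  case less
  show ?case
  proof (cases "lk e = head G e")
    case True
    then show ?thesis using less.prems by auto
  next
    case False
    then obtain f where f: "f \<in> arcs G" "tail G f = head G e" "lk f = lk e"
      using relay less.prems by blast
    then have lt: "k e < k f" using order[of f e] less.prems False by auto
    moreover have "k f \<le> Max (k ` arcs G)" using f(1) by simp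
    ultimately have "Max (k ` arcs G) - k f < Max (k ` arcs G) - k e" by linarith
    then obtain g where "g \<in> arcs G" "lk g = lk f" "head G g = lk f" "k f \<le> k g"
      using less.hyps f(1) by blast
    then show ?thesis using f lt by (intro bexI[of _ g]) auto
  qed
qed

lemma lock_in_verts: "e \<in> arcs G \<Longrightarrow> lk e \<in> verts G"
  using walk_to_lock head_in_verts by metis

section \<open>Creation times and the tree of foreign protectors\<close>

definition last_creation :: "'a \<Rightarrow> nat" where
  "last_creation y = Max (insert 0 ((\<lambda>e. Suc (k e)) ` {e \<in> arcs G. lk e = y}))"

lemma last_creation_ge: "e \<in> arcs G \<Longrightarrow> k e < last_creation (lk e)"
  unfolding last_creation_def by (rule Suc_le_lessD, rule Max_ge) auto

text \<open>Among the arcs protected by \<open>tail G e\<close>, take one created last. By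
  \<open>walk_to_lock\<close> an arc created no earlier enters \<open>tail G e\<close>, and
  \<open>order\<close> puts that one before \<open>e\<close>. If the tail protects no arc, its value
  is 0, which is below the successor of any creation time.\<close>

lemma last_creation_less:
  assumes e: "e \<in> arcs G" and "lk e \<noteq> tail G e"
  shows "last_creation (tail G e) < last_creation (lk e)"
proof -
  have "last_creation (tail G e) \<in> insert 0 ((\<lambda>f. Suc (k f)) ` {f \<in> arcs G. lk f = tail G e})"
    unfolding last_creation_def by (rule Max_in) auto
  then have "last_creation (tail G e) \<le> k e"
  proof
    assume "last_creation (tail G e) \<in> (\<lambda>f. Suc (k f)) ` {f \<in> arcs G. lk f = tail G e}"
    then obtain f where f: "f \<in> arcs G" "lk f = tail G e" "last_creation (tail G e) = Suc (k f)"
      by auto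
    then obtain g where "g \<in> arcs G" "head G g = tail G e" "k f \<le> k g"
      using walk_to_lock[of f] by auto
    then show ?thesis using order[of e g] assms f(3) by auto
  qed simp
  then show ?thesis using last_creation_ge[OF e] by simp
qed

definition lock_tree :: "'a \<Rightarrow> ('a \<Rightarrow> 'a) \<Rightarrow> bool" where
  "lock_tree r par \<longleftrightarrow> r \<in> verts G \<and>
     (\<forall>e\<in>arcs G. head G e = r \<or> tail G e = r \<longrightarrow> lk e = r) \<and>
     (\<forall>v\<in>verts G - {r}. par v \<in> verts G \<and> last_creation v < last_creation (par v) \<and>
        (\<exists>e\<in>arcs G. head G e = v \<and> lk e = par v) \<and>
        (\<exists>e\<in>arcs G. tail G e = v \<and> lk e = par v) \<and>
        (\<forall>e\<in>arcs G. head G e = v \<or> tail G e = v \<longrightarrow> lk e \<in> {v, par v})) \<and>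
     (\<forall>v\<in>verts G. (v, r) \<in> {(c, par c) | c. c \<in> verts G - {r}}\<^sup>*)"

text \<open>A party whose protected arcs are completed last has no foreign protector; it is the root. The
  vertices whose chain of foreign protectors ends there are closed under successors.\<close>

lemma ex_lock_tree: "\<exists>r par. lock_tree r par"
proof -
  \<comment> \<open>The choice is harmless: all foreign protectors at a vertex coincide, as shown
    next.\<close>
  define par where "par v = lk (SOME e. e \<in> arcs G \<and> head G e = v \<and> lk e \<noteq> v)" for v
  define nonroot where "nonroot v \<longleftrightarrow> (\<exists>e\<in>arcs G. head G e = v \<and> lk e \<noteq> v)" for v
  have par: "par v \<in> verts G \<and> last_creation v < last_creation (par v) \<and>
        (\<exists>e\<in>arcs G. head G e = v \<and> lk e = par v) \<and>
        (\<exists>e\<in>arcs G. tail G e = v \<and> lk e = par v) \<and>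
        (\<forall>e\<in>arcs G. head G e = v \<or> tail G e = v \<longrightarrow> lk e \<in> {v, par v})"
    if "nonroot v" for v
  proof -
    have "\<exists>e. e \<in> arcs G \<and> head G e = v \<and> lk e \<noteq> v" using that nonroot_def by auto
    then obtain e where e: "e \<in> arcs G" "head G e = v" "lk e \<noteq> v" "par v = lk e"
      unfolding par_def by (metis (mono_tags, lifting) someI)
    then obtain f where f: "f \<in> arcs G" "tail G f = v" "lk f = lk e" using relay by blast
    \<comment> \<open>An incoming arc is compared with the foreign outgoing arc \<open>f\<close>,
      and a foreign outgoing arc with the foreign incoming arc \<open>e\<close>; both comparisons
      are instances of \<open>order\<close>.\<close>
    have "lk g \<in> {v, lk e}" if g: "g \<in> arcs G" "head G g = v \<or> tail G g = v" for g
    proof (cases "head G g = v")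
      case True then show ?thesis using g order[of f g] e f by auto
    next
      case False then show ?thesis using g order[of g e] e by (cases "lk g = v") auto
    qed
    then show ?thesis using e f lock_in_verts last_creation_less[of f] by auto
  qed
  have "verts G \<noteq> {}" using strong by (simp add: strongly_connected_def)
  then have "Max (last_creation ` verts G) \<in> last_creation ` verts G" by (intro Max_in) auto
  then obtain r where r_max: "r \<in> verts G" "last_creation r = Max (last_creation ` verts G)" by auto
  then have r: "r \<in> verts G" "\<forall>v\<in>verts G. last_creation v \<le> last_creation r" by auto
  have r_root: "\<not> nonroot r" using par[of r] r(2) by force
  have r_arcs: "lk e = r" if "e \<in> arcs G" "head G e = r \<or> tail G e = r" for e
    using that r_root last_creation_less[of e] r lock_in_verts[of e]
    unfolding nonroot_def by force
  define R where "R = {(c, par c) | c. nonroot c}"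
  have clos: "(q, r) \<in> R\<^sup>*" if pq: "p \<rightarrow>\<^bsub>G\<^esub> q" and p: "(p, r) \<in> R\<^sup>*" for p q
  proof -
    obtain e where e: "e \<in> arcs G" "tail G e = p" "head G e = q" using pq by auto
    \<comment> \<open>The two ends of \<open>e\<close> are linked through its protector, which is
      each end itself or its parent. So the chain of \<open>p\<close> passes to \<open>lk e\<close>
      and from there to \<open>q\<close>.\<close>
    have lk_e: "(lk e, r) \<in> R\<^sup>*"
    proof (cases "p = r")
      case True then show ?thesis using r_arcs e by auto
    next
      case False
      then have "(p, par p) \<in> R" "(par p, r) \<in> R\<^sup>*" "nonroot p"
        using p R_def by (auto elim: converse_rtranclE)
      then show ?thesis using par[of p] e p by auto
    qed
    show ?thesis
    proof (cases "nonroot q")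
      case True
      then have "(q, par q) \<in> R" "lk e \<in> {q, par q}" using par[of q] e unfolding R_def by auto
      then show ?thesis using lk_e by (auto intro: converse_rtrancl_into_rtrancl)
    next
      case False then show ?thesis using lk_e e nonroot_def by force
    qed
  qed
  have all: "(v, r) \<in> R\<^sup>*" if "v \<in> verts G" for v
  proof -
    have "r \<rightarrow>\<^sup>*\<^bsub>G\<^esub> v" using strong that r by auto
    then show ?thesis by (induction rule: reachable_induct) (auto intro: clos)
  qed
  have nr: "nonroot v" if "v \<in> verts G - {r}" for v
    using all[of v] that unfolding R_def by (auto elim: converse_rtranclE)
  have "R = {(c, par c) | c. c \<in> verts G - {r}}"
    unfolding R_def using nr r_root by (auto simp: nonroot_def)
  then show ?thesis unfolding lock_tree_def using r r_arcs par nr all by blast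
qed

section \<open>From a lock schedule to a decomposition into components\<close>

lemma lock_tree_root:
  assumes "lock_tree r par"
  shows "r \<in> verts G" "e \<in> arcs G \<Longrightarrow> head G e = r \<or> tail G e = r \<Longrightarrow> lk e = r"
  using assms by (auto simp: lock_tree_def)

lemma lock_tree_parent:
  assumes "lock_tree r par" "v \<in> verts G" "v \<noteq> r"
  shows "last_creation v < last_creation (par v)"
    "\<exists>e\<in>arcs G. head G e = v \<and> lk e = par v"
    "\<exists>e\<in>arcs G. tail G e = v \<and> lk e = par v"
    "e \<in> arcs G \<Longrightarrow> head G e = v \<or> tail G e = v \<Longrightarrow> lk e \<in> {v, par v}"
  using assms unfolding lock_tree_def by auto

lemma lock_tree_path:
  "lock_tree r par \<Longrightarrow> v \<in> verts G \<Longrightarrow> (v, r) \<in> {(c, par c) | c. c \<in> verts G - {r}}\<^sup>*"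
  unfolding lock_tree_def by blast

text \<open>The component of \<open>b\<close> consists of the arcs protected by \<open>b\<close> and
  their ends, and the tree is \<open>par\<close> restricted to the parties that protect an arc. The
  root is inserted explicitly to cover the digraph with one vertex and no arcs.\<close>

theorem reuniclus: "reuniclus G"
proof -
  obtain r par where str: "lock_tree r par" using ex_lock_tree by blast
  note S_r = lock_tree_root(1)[OF str] and S_root = lock_tree_root(2)[OF str]
    and S_tree = lock_tree_path[OF str] and S_par = lock_tree_parent[OF str]
  define A where "A b = {e \<in> arcs G. lk e = b}" for b
  define V where "V b = insert b (tail G ` A b \<union> head G ` A b)" for b
  define K where "K b = \<lparr>verts = V b, arcs = A b, tail = tail G, head = head G\<rparr>" for b
  define B where "B = insert r (lk ` arcs G)"
  have BV: "B \<subseteq> verts G" using S_r lock_in_verts by (auto simp: B_def)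
  have parB: "par v \<in> B" if "v \<in> verts G - {r}" for v
    using S_par(2)[of v] that unfolding B_def by (metis Diff_iff image_eqI insertCI)
  \<comment> \<open>Membership in a component is thus read off from the tree alone, which yields
    both counting conditions on vertices at the end.\<close>
  have V_iff: "v \<in> V b \<longleftrightarrow> v = b \<or> (v \<noteq> r \<and> b = par v)" if "v \<in> verts G" "b \<in> B" for v b
  proof
    assume "v \<in> V b"
    then consider "v = b" | e where "e \<in> arcs G" "lk e = b" "head G e = v \<or> tail G e = v"
      unfolding V_def A_def by auto
    then show "v = b \<or> v \<noteq> r \<and> b = par v"
    proof cases
      case 2
      then show ?thesis using S_root S_par(4)[of v e] that by (cases "v = r") auto
    qed simp
  next
    assume "v = b \<or> v \<noteq> r \<and> b = par v"
    then show "v \<in> V b"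
      using S_par(2)[of v] that unfolding V_def A_def by auto
  qed
  have lk_ends: "lk e = v \<or> (v \<noteq> r \<and> lk e = par v)" 
    if "e \<in> arcs G" "head G e = v \<or> tail G e = v" for e v
    using V_iff[of v "lk e"] that unfolding V_def A_def B_def by auto
  have lt: "last_creation v < last_creation (par v)" if "v \<in> verts G" "v \<noteq> r" for v 
    using S_par(1) that .
  have tree: "rooted_tree B r par"
  proof -
    \<comment> \<open>A chain of parents that starts in \<open>B\<close> stays in \<open>B\<close>,
      since every parent protects an arc.\<close>
    have "(v, r) \<in> {(c, par c) | c. c \<in> verts G - {r}}\<^sup>* \<Longrightarrow>
       v \<in> B \<Longrightarrow> (v, r) \<in> {(c, par c) | c. c \<in> B - {r}}\<^sup>*" for v
    proof (induction rule: converse_rtrancl_induct)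
      case (step y z)
      then have "(y, z) \<in> {(c, par c) | c. c \<in> B - {r}}" "z \<in> B" using parB by auto
      then show ?case using step.IH by (meson converse_rtrancl_into_rtrancl)
    qed simp
    then have "\<forall>b\<in>B. (b, r) \<in> {(c, par c) | c. c \<in> B - {r}}\<^sup>*"
      using S_tree BV by blast
    moreover have "finite B" "r \<in> B" by (auto simp: B_def)
    moreover have "\<forall>b\<in>B - {r}. par b \<in> B" using parB BV by blast
    ultimately show ?thesis unfolding rooted_tree_def by blast
  qed
  have ind: "induced_subgraph (K b) G" if b: "b \<in> B" for b
  proof -
    have "e \<in> A b" if e: "e \<in> arcs G" "tail G e \<in> V b" "head G e \<in> V b" for e
    proof (rule ccontr)
      assume "e \<notin> A b"
      then have ne: "lk e \<noteq> b" using e by (simp add: A_def)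
      let ?u = "tail G e" and ?v = "head G e"
      have uv: "?u \<noteq> ?v" using no_loops e by simp
      have verts: "?u \<in> verts G" "?v \<in> verts G" using e by auto
      have u: "?u = b \<or> ?u \<noteq> r \<and> b = par ?u" using V_iff[of ?u b] verts b e by auto
      have v: "?v = b \<or> ?v \<noteq> r \<and> b = par ?v" using V_iff[of ?v b] verts b e by auto
      have lu: "lk e = ?u \<or> ?u \<noteq> r \<and> lk e = par ?u" using lk_ends e by blast
      have lv: "lk e = ?v \<or> ?v \<noteq> r \<and> lk e = par ?v" using lk_ends e by blast
      \<comment> \<open>Two distinct children of \<open>b\<close> cannot both be the protector
        \<open>lk e\<close>. If one end is \<open>b\<close> itself, the other would be both its
        child and its parent, which \<open>last_creation\<close> forbids.\<close>
      show False
        using u v lu lv uv ne lt[of ?u] lt[of ?v] verts by auto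
    qed
    moreover have "A b \<subseteq> {e \<in> arcs G. tail G e \<in> V b \<and> head G e \<in> V b}"
      by (auto simp: A_def V_def)
    ultimately have "arcs (K b) = {e \<in> arcs G. tail G e \<in> verts (K b) \<and> head G e \<in> verts (K b)}"
      by (auto simp: K_def A_def)
    moreover have "subgraph (K b) G"
    proof (rule subgraphI)
      show "verts (K b) \<subseteq> verts G" using b BV by (auto simp: K_def V_def A_def)
      show "arcs (K b) \<subseteq> arcs G" by (auto simp: K_def A_def)
      show "wf_digraph (K b)" by unfold_locales (auto simp: K_def V_def)
      show "compatible G (K b)" by (auto simp: compatible_def K_def)
    qed (rule wf_digraph)
    ultimately show ?thesis by (simp add: induced_subgraph_def)
  qed
  have bottle: "bottleneck_digraph (K b) b" if b: "b \<in> B" for b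
  proof -
    interpret Kb: wf_digraph "K b" by unfold_locales (auto simp: K_def V_def)
    have vK: "verts (K b) = V b" and aK: "arcs (K b) = A b" and tK: "tail (K b) = tail G"
      and hK: "head (K b) = head G" by (auto simp: K_def)
    have adj: "tail G e \<rightarrow>\<^bsub>K b\<^esub> head G e" if "e \<in> A b" for e
      using that by (auto simp: arcs_ends_conv K_def)
    have bV: "b \<in> V b" by (simp add: V_def)
    \<comment> \<open>Towards \<open>b\<close>: \<open>relay\<close> stays among the arcs protected
      by \<open>b\<close>, with increasing creation times.\<close>
    have fwd: "head G e \<rightarrow>\<^sup>*\<^bsub>K b\<^esub> b" if "e \<in> A b" for e
      using that
    proof (induction "Max (k ` arcs G) - k e" arbitrary: e rule: less_induct)
      case less
      show ?case
      proof (cases "head G e = b")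
        case True then show ?thesis using bV vK by auto
      next
        case False
        then obtain f where f: "f \<in> arcs G" "tail G f = head G e" "lk f = b"
          using relay[of e] less.prems by (auto simp: A_def)
        then have "k e < k f" using order[of f e] less.prems False by (auto simp: A_def)
        moreover have "k f \<le> Max (k ` arcs G)" using f(1) by simp
        ultimately have "Max (k ` arcs G) - k f < Max (k ` arcs G) - k e" by linarith
        then have "head G f \<rightarrow>\<^sup>*\<^bsub>K b\<^esub> b"
          using less.hyps[of f] f by (simp add: A_def)
        moreover have "head G e \<rightarrow>\<^bsub>K b\<^esub> head G f" using adj[of f] f by (simp add: A_def)
        ultimately show ?thesis by (meson Kb.adj_reachable_trans)
      qed
    qed
    \<comment> \<open>From \<open>b\<close>: a tail other than \<open>b\<close> has parent
      \<open>b\<close>, hence an incoming arc protected by \<open>b\<close>, which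
      \<open>order\<close> places earlier.\<close>
    have bwd: "b \<rightarrow>\<^sup>*\<^bsub>K b\<^esub> tail G e" if "e \<in> A b" for e
      using that
    proof (induction "k e" arbitrary: e rule: less_induct)
      case less
      show ?case
      proof (cases "tail G e = b")
        case True then show ?thesis using bV vK by auto
      next
        case False
        have e: "e \<in> arcs G" "lk e = b" using less.prems by (auto simp: A_def)
        have te: "tail G e \<noteq> r" "par (tail G e) = b"
          using lk_ends[of e "tail G e"] e False by auto
        obtain f where f: "f \<in> arcs G" "head G f = tail G e" "lk f = par (tail G e)"
          using S_par(2)[OF tail_in_verts te(1)] e(1) by blast
        then have fA: "f \<in> A b" using te by (simp add: A_def)
        have "k f < k e" using order[OF e(1) f(1,2)] e False by simp
        then have "b \<rightarrow>\<^sup>*\<^bsub>K b\<^esub> tail G f" using less.hyps fA by blast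
        moreover have "tail G f \<rightarrow>\<^bsub>K b\<^esub> tail G e" using adj[OF fA] f(2) by simp
        ultimately show ?thesis by (meson Kb.reachable_adj_trans)
      qed
    qed
    have bb: "b \<rightarrow>\<^sup>*\<^bsub>K b\<^esub> b" using bV vK by auto
    have conn: "v \<rightarrow>\<^sup>*\<^bsub>K b\<^esub> b \<and> b \<rightarrow>\<^sup>*\<^bsub>K b\<^esub> v" if "v \<in> V b" for v
      using that bb fwd bwd adj unfolding V_def
      by (auto intro: Kb.adj_reachable_trans Kb.reachable_adj_trans)
    have "strongly_connected (K b)"
      using bV vK conn by (intro strongly_connectedI) (auto intro: Kb.reachable_trans)
    \<comment> \<open>On a cycle avoiding \<open>b\<close>, every arc would be created strictly
      after its predecessor, all the way round.\<close>
    moreover have "b \<in> tail (K b) ` set p" if p: "Kb.cycle p" for p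
    proof (rule ccontr)
      assume nb: "b \<notin> tail (K b) ` set p"
      then have nb': "tail G e \<noteq> b" if "e \<in> set p" for e using that tK by (metis image_eqI)
      obtain u where u: "Kb.awalk u p u" "p \<noteq> []" using p by (auto simp: Kb.cycle_def)
      have inc: "k (hd q) \<le> k (last q)" 
        if "Kb.cas x q y" "q \<noteq> []" "set q \<subseteq> set p" for q x y
        using that
      proof (induction q arbitrary: x)
        case (Cons e q)
        show ?case
        proof (cases q)
          case (Cons f q')
          have ef: "e \<in> A b" "f \<in> A b" "tail G f \<noteq> b" "head G e = tail G f"
            using Cons Cons.prems u(1) nb'[of f] tK hK aK by (auto simp: Kb.awalk_def)
          have "k e < k f" using order[of f e] ef by (auto simp: A_def)
          then show ?thesis using Cons.IH[of "head G e"] Cons.prems Cons hK by auto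
        qed simp
      qed simp
      have "head G (last q) = y \<and> tail G (hd q) = x" if "Kb.cas x q y" "q \<noteq> []" for q x y
        using that by (induction q arbitrary: x) (auto simp: tK hK)
      then have "head G (last p) = u" "tail G (hd p) = u" using u unfolding Kb.awalk_def by blast+
      moreover have "hd p \<in> A b" "last p \<in> A b" "tail G (hd p) \<noteq> b"
        using u nb'[of "hd p"] aK unfolding Kb.awalk_def by auto
      \<comment> \<open>The strict inequality comes from the junction of the last arc with the first
        one. It contradicts \<open>inc\<close>, which is weak because it includes a single
        arc.\<close>
      ultimately have "k (last p) < k (hd p)" using order[of "hd p" "last p"] by (auto simp: A_def)
      then show False using inc[of u p u] u unfolding Kb.awalk_def by auto
    qed
    ultimately show ?thesis unfolding bottleneck_digraph_def using bV vK by blast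
  qed
  have arcs1: "\<exists>!b. b \<in> B \<and> e \<in> arcs (K b)" if "e \<in> arcs G" for e
    using that by (auto simp: K_def A_def B_def)
  have verts1: "\<exists>!b. b \<in> B \<and> v \<in> verts (K b)" if v: "v \<in> verts G - (B - {r})" for v
  proof (cases "v = r")
    case True
    then show ?thesis using V_iff[of r] v by (auto simp: K_def B_def)
  next
    case False
    then have "v \<notin> B" using v by auto
    then show ?thesis using V_iff[of v] v parB[of v] False by (intro ex1I[of _ "par v"]) (auto simp: K_def)
  qed
  have verts2: "{c \<in> B. b \<in> verts (K c)} = {b, par b}" if "b \<in> B - {r}" for b
    using V_iff[of b] that BV parB[of b] by (auto simp: K_def)
  show ?thesis
    unfolding reuniclus_def
    by (intro conjI exI[of _ B] exI[of _ r] exI[of _ par] exI[of _ K] ballI strong BV tree ind bottle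
        arcs1 verts1 verts2)
qed

end

section \<open>Lock schedules of reuniclus digraphs\<close>

text \<open>The depth is the least number of parent steps to the root. The first of these steps
  leads to the parent, which needs one step less.\<close>

lemma rooted_tree_depth:
  assumes "rooted_tree B r parent"
  shows "\<exists>d :: 'a \<Rightarrow> nat. \<forall>b\<in>B - {r}. d (parent b) < d b"
proof -
  define R where "R = {(c, parent c) | c. c \<in> B - {r}}"
  define d where "d b = (LEAST n. (b, r) \<in> R ^^ n)" for b
  have "d (parent b) < d b" if b: "b \<in> B - {r}" for b
  proof -
    have "(b, r) \<in> R\<^sup>*" using assms b unfolding rooted_tree_def R_def by blast
    then have "\<exists>n. (b, r) \<in> R ^^ n" by (simp add: rtrancl_power)
    then have db: "(b, r) \<in> R ^^ d b" unfolding d_def by (rule LeastI_ex)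
    moreover have "b \<noteq> r" using b by simp
    ultimately obtain m where m: "d b = Suc m" by (cases "d b") auto
    then obtain c where "(b, c) \<in> R" "(c, r) \<in> R ^^ m" using db relpow_Suc_D2 by metis
    then have "(parent b, r) \<in> R ^^ m" by (auto simp: R_def)
    then have "d (parent b) \<le> m" unfolding d_def by (rule Least_le)
    then show ?thesis using m by simp
  qed
  then show ?thesis by blast
qed

text \<open>A cycle of the relation gives a closed walk after deletion of the arcs leaving
  \<open>b\<close>. This walk contains a cycle of the digraph with no arc leaving
  \<open>b\<close>.\<close>

lemma (in wf_digraph) no_closed_walk_avoiding_bottleneck:
  assumes "bottleneck_digraph G b"
  shows "acyclic {(f, e). e \<in> arcs G \<and> f \<in> arcs G \<and> head G f = tail G e \<and> tail G e \<noteq> b}"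
    (is "acyclic ?R")
proof (rule acyclicI, intro allI notI)
  fix e assume ee: "(e, e) \<in> ?R\<^sup>+"
  define H where "H = \<lparr>verts = verts G, arcs = {e \<in> arcs G. tail G e \<noteq> b},
    tail = tail G, head = head G\<rparr>"
  interpret H: wf_digraph H by unfold_locales (auto simp: H_def)
  \<comment> \<open>The walk starts at the head of \<open>f\<close>, so it uses only arcs that occur
    as second components; these have a tail different from \<open>b\<close>.\<close>
  have "\<exists>p. p \<noteq> [] \<and> H.awalk (head G f) p (head G e)" if "(f, e) \<in> ?R\<^sup>+" for f e
    using that
  proof (induction rule: converse_trancl_induct)
    case (base f)
    then have "H.awalk (head G f) [e] (head G e)" unfolding H.awalk_def by (auto simp: H_def pre_digraph.cas.simps)
    then show ?case by blast
  next
    case (step f g)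
    then obtain p where "p \<noteq> []" "H.awalk (head G g) p (head G e)" by blast
    then have "H.awalk (head G f) (g # p) (head G e)"
      using step.hyps(1) unfolding H.awalk_def by (auto simp: H_def pre_digraph.cas.simps)
    then show ?case by blast
  qed
  then obtain p where "p \<noteq> []" "H.awalk (head G e) p (head G e)" using ee by blast
  then obtain c where c: "H.cycle c" using H.closed_w_imp_cycle[of p] by (auto simp: H.closed_w_def)
  have cas: "H.cas u q v = cas u q v" for u q v
    by (induction q arbitrary: u) (auto simp: pre_digraph.cas.simps H_def)
  have vts: "H.awalk_verts u q = awalk_verts u q" for u q
    by (induction q arbitrary: u) (auto simp: pre_digraph.awalk_verts.simps H_def)
  have "cycle c" "b \<notin> tail G ` set c"
    using c unfolding H.cycle_def cycle_def H.awalk_def awalk_def cas vts by (auto simp: H_def)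
  then show False using assms unfolding bottleneck_digraph_def by blast
qed

text \<open>The rank counts the predecessors under the transitive closure; by acyclicity
  \<open>f\<close> counts for \<open>e\<close> but not for itself.\<close>

lemma ex_rank_of_finite_acyclic:
  assumes "finite R" "acyclic R"
  shows "\<exists>k :: 'a \<Rightarrow> nat. \<forall>(f, e)\<in>R. k f < k e"
proof -
  define k where "k e = card {f. (f, e) \<in> R\<^sup>+}" for e
  have "k f < k e" if "(f, e) \<in> R" for f e
  proof -
    have "finite (R\<^sup>+)" using assms(1) by simp
    then have "finite {f. (f, e) \<in> R\<^sup>+}"
      by (rule finite_subset[rotated, OF finite_imageI[of _ fst]]) force
    moreover have "{g. (g, f) \<in> R\<^sup>+} \<subset> {g. (g, e) \<in> R\<^sup>+}"
    proof -
      have "f \<in> {g. (g, e) \<in> R\<^sup>+}" "f \<notin> {g. (g, f) \<in> R\<^sup>+}"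
        using that assms(2) by (auto simp: acyclic_def)
      moreover have "{g. (g, f) \<in> R\<^sup>+} \<subseteq> {g. (g, e) \<in> R\<^sup>+}"
        using that by (auto intro: trancl_into_trancl)
      ultimately show ?thesis by blast
    qed
    ultimately show ?thesis unfolding k_def by (rule psubset_card_mono)
  qed
  then show ?thesis by blast
qed

text \<open>Along a chain of arcs, each to be created after its predecessor, the protector either stays the same or
  moves up the tree. So a cyclic chain would lie in a single component and avoid its
  bottleneck.\<close>

lemma reuniclus_imp_lock_schedule:
  assumes dig: "digraph G" and reu: "reuniclus G"
  shows "\<exists>lk k. lock_schedule G lk k"
proof -
  interpret digraph G by (rule dig)
  obtain B r parent K where sc: "strongly_connected G" and B: "B \<subseteq> verts G"
    and tree: "rooted_tree B r parent"
    and comp: "\<forall>b\<in>B. induced_subgraph (K b) G \<and> bottleneck_digraph (K b) b"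
    and arcs_ex1: "\<forall>e\<in>arcs G. \<exists>!b. b \<in> B \<and> e \<in> arcs (K b)"
    and verts_ex1: "\<forall>v\<in>verts G - (B - {r}). \<exists>!b. b \<in> B \<and> v \<in> verts (K b)"
    and verts_two: "\<forall>b\<in>B - {r}. {c \<in> B. b \<in> verts (K c)} = {b, parent b}"
    using reu unfolding reuniclus_def by (elim conjE exE) (rule that; assumption)
  have ind: "\<And>b. b \<in> B \<Longrightarrow> induced_subgraph (K b) G"
    and bot: "\<And>b. b \<in> B \<Longrightarrow> bottleneck_digraph (K b) b" using comp by auto
  note arcs1 = bspec[OF arcs_ex1] and verts2 = bspec[OF verts_two]
  have verts1: "\<exists>!b. b \<in> B \<and> v \<in> verts (K b)" if "v \<in> verts G" "v \<notin> B - {r}" for v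
    using bspec[OF verts_ex1, of v] that by simp
  obtain d :: "'a \<Rightarrow> nat" where d: "\<And>b. b \<in> B - {r} \<Longrightarrow> d (parent b) < d b"
    using rooted_tree_depth[OF tree] by blast
  have rB: "r \<in> B" using tree by (simp add: rooted_tree_def)
  have wfK: "wf_digraph (K b)" and tK: "tail (K b) = tail G" and hK: "head (K b) = head G"
    and aK: "arcs (K b) \<subseteq> arcs G" if "b \<in> B" for b
    using ind[OF that] by (auto simp: induced_subgraph_def subgraph_def compatible_def)
  have bK: "b \<in> verts (K b)" if "b \<in> B" for b
    using bot[OF that] by (simp add: bottleneck_digraph_def)
  define lk where "lk e = (THE b. b \<in> B \<and> e \<in> arcs (K b))" for e
  have lk: "lk e \<in> B" "e \<in> arcs (K (lk e))" if "e \<in> arcs G" for e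
    using theI'[OF arcs1[OF that]] unfolding lk_def by auto
  have lk_eq: "lk e = b" if "e \<in> arcs (K b)" "b \<in> B" for e b
    using arcs1[of e] lk[of e] that aK by blast
  have ends: "tail G e \<in> verts (K (lk e))" "head G e \<in> verts (K (lk e))" if "e \<in> arcs G" for e
    using wfK[OF lk(1)[OF that]] lk[OF that] tK hK wf_digraph.tail_in_verts wf_digraph.head_in_verts
    by metis+
  \<comment> \<open>Apart from its own component, a vertex lies in at most one, and then in that of
    its parent if it is itself a bottleneck. A root lies in its own component only.\<close>
  have other: "v \<noteq> r \<and> c = b \<and> (v \<in> B \<longrightarrow> b = parent v)"
    if "v \<in> verts (K b)" "b \<in> B" "b \<noteq> v" "v \<in> verts (K c)" "c \<in> B" "c \<noteq> v" for v b c
  proof -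
    have vG: "v \<in> verts G" using that ind[OF \<open>b \<in> B\<close>] by (auto simp: induced_subgraph_def subgraph_def)
    show ?thesis
    proof (cases "v \<in> B")
      case True
      show ?thesis
      proof (cases "v = r")
        case True
        then have "b = v" using verts1[of v] vG rB bK[OF rB] that(1,2) by blast
        then show ?thesis using that by simp
      next
        case False
        then have "{c \<in> B. v \<in> verts (K c)} = {v, parent v}" using verts2 True by simp
        then have "b \<in> {v, parent v}" "c \<in> {v, parent v}" using that by blast+
        then show ?thesis using that False by auto
      qed
    next
      case False
      then show ?thesis using verts1[of v] vG that rB by auto
    qed
  qed
  define R where "R = {(f, e). e \<in> arcs G \<and> f \<in> arcs G \<and> head G f = tail G e \<and> lk e \<noteq> tail G e}"
  \<comment> \<open>If the protector changes, the tail of \<open>e\<close> is a non-root bottleneck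
    lying in the component of \<open>e\<close>, so \<open>lk e\<close> is its parent and has smaller
    depth.\<close>
  have lock_step: "lk f = lk e \<or> (lk f = tail G e \<and> d (lk e) < d (lk f))"
    if "(f, e) \<in> R" for f e
  proof -
    have h: "e \<in> arcs G" "f \<in> arcs G" "head G f = tail G e" "lk e \<noteq> tail G e"
      using that by (auto simp: R_def)
    show ?thesis
    proof (cases "lk f = tail G e")
      case True
      have "tail G e \<noteq> r \<and> (tail G e \<in> B \<longrightarrow> lk e = parent (tail G e))"
        using other[of "tail G e" "lk e" "lk e"] ends h lk by auto
      moreover have "tail G e \<in> B" using lk[OF h(2)] True by simp
      ultimately have "d (lk e) < d (tail G e)" using d[of "tail G e"] by simp
      then show ?thesis using True by simp
    next
      case False
      then show ?thesis using other[of "tail G e" "lk e" "lk f"] ends[OF h(1)] ends[OF h(2)] h lk by auto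
    qed
  qed
  have mono: "d (lk e) \<le> d (lk f)" if "(f, e) \<in> R\<^sup>*" for f e
    using that by (induction rule: rtrancl_induct) (use lock_step in force)+
  define Q where "Q b = {(f, e). e \<in> arcs (K b) \<and> f \<in> arcs (K b) \<and> head (K b) f = tail (K b) e \<and>
    tail (K b) e \<noteq> b}" for b
  \<comment> \<open>Depth never grows along a chain, so a chain that returns to its initial depth
    never changes its protector and runs inside one component.\<close>
  have const: "(f, e) \<in> (Q (lk f))\<^sup>+ \<and> lk e = lk f" if "(f, e) \<in> R\<^sup>+" "d (lk f) \<le> d (lk e)" for f e
    using that
  proof (induction rule: trancl_induct)
    case (base e)
    then have eq: "lk e = lk f" using lock_step by force
    then have "(f, e) \<in> Q (lk f)" 
      using base lk[of f] lk[of e] tK hK unfolding R_def Q_def by auto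
    then show ?case using eq by blast
  next
    case (step g e)
    have "d (lk e) \<le> d (lk g)" "d (lk g) \<le> d (lk f)"
      using mono[of g e] mono[of f g] step.hyps by (auto dest: trancl_into_rtrancl)
    then have g: "(f, g) \<in> (Q (lk f))\<^sup>+" "lk g = lk f" using step by auto
    have eq: "lk e = lk g" using lock_step step.hyps(2) step.prems g(2) by force
    then have "(g, e) \<in> Q (lk f)" 
      using step.hyps(2) lk[of g] lk[of e] tK hK g(2) unfolding R_def Q_def by auto
    then show ?case using g eq by (metis trancl.trancl_into_trancl)
  qed
  have "acyclic R"
  proof (rule acyclicI, intro allI notI)
    fix e assume "(e, e) \<in> R\<^sup>+"
    then have "(e, e) \<in> (Q (lk e))\<^sup>+" "e \<in> arcs G"
      using const by (auto simp: R_def dest: tranclD)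
    moreover have "acyclic (Q (lk e))" if "e \<in> arcs G"
      using wf_digraph.no_closed_walk_avoiding_bottleneck[OF wfK bot] lk that unfolding Q_def by blast
    ultimately show False by (auto simp: acyclic_def)
  qed
  moreover have "finite R"
    by (rule finite_subset[of _ "arcs G \<times> arcs G"]) (auto simp: R_def)
  ultimately obtain k :: "'b \<Rightarrow> nat" where k: "\<forall>(f, e)\<in>R. k f < k e"
    using ex_rank_of_finite_acyclic by blast
  have "lock_schedule G lk k"
  proof unfold_locales
    show "strongly_connected G" by (rule sc)
  next
    fix e assume e: "e \<in> arcs G" "lk e \<noteq> head G e"
    interpret Kb: wf_digraph "K (lk e)" using wfK lk e by blast
    \<comment> \<open>By strong connectivity of the component, the first arc of a path to its
      bottleneck is the required relay.\<close>
    have "head G e \<rightarrow>\<^sup>*\<^bsub>K (lk e)\<^esub> lk e"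
      using bot[OF lk(1)[OF e(1)]] ends[OF e(1)] bK[OF lk(1)[OF e(1)]]
      unfolding bottleneck_digraph_def by (auto simp: strongly_connected_def)
    then obtain w where "head G e \<rightarrow>\<^bsub>K (lk e)\<^esub> w"
      using e(2) by (cases rule: Kb.converse_reachable_cases) auto
    then obtain f where "f \<in> arcs (K (lk e))" "tail G f = head G e"
      using tK[OF lk(1)[OF e(1)]] by (auto simp: arcs_ends_conv)
    then show "\<exists>f\<in>arcs G. tail G f = head G e \<and> lk f = lk e"
      using aK lk_eq lk(1)[OF e(1)] by blast
  next
    fix e f assume h: "e \<in> arcs G" "f \<in> arcs G" "head G f = tail G e" "lk e \<noteq> tail G e"
    then have "(f, e) \<in> R" by (auto simp: R_def)
    then show "k f < k e \<and> lk f \<in> {tail G e, lk e}" using lock_step k by auto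
  qed
  then show ?thesis by blast
qed

section \<open>Runs of a protocol\<close>

definition state_at :: "('a, 'b) pre_digraph \<Rightarrow> ('a \<Rightarrow> ('a, 'b) strategy) \<Rightarrow> nat \<Rightarrow> ('a, 'b) state" where
  "state_at G \<sigma> t = last (history G \<sigma> t)"

definition move_at :: "('a, 'b) pre_digraph \<Rightarrow> ('a \<Rightarrow> ('a, 'b) strategy) \<Rightarrow> nat \<Rightarrow> 'a \<Rightarrow> ('a, 'b) move" where
  "move_at G \<sigma> t v = \<sigma> v (map (view G v) (history G \<sigma> t))"

text \<open>The intermediate state inside \<open>step\<close>, against which the knowledge of the
  parties is tested: a fresh pair is already usable in the step that creates it.\<close>

definition with_new_pairs ::
  "('a, 'b) pre_digraph \<Rightarrow> ('a \<Rightarrow> ('a, 'b) move) \<Rightarrow> ('a, 'b) state \<Rightarrow> ('a, 'b) state" where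
  "with_new_pairs G m s = s\<lparr>paired := paired s \<union> {v \<in> verts G. new_pair (m v)}\<rparr>"

definition no_move :: "('a, 'b) move" where
  "no_move = \<lparr>new_pair = False, create = Map.empty, claim = {}, send_hash = {}, send_secret = {}\<rparr>"

lemma no_move_simps [simp]:
  "\<not> new_pair no_move" "create no_move e = None" "claim no_move = {}" "send_hash no_move = {}"
  "send_secret no_move = {}"
  by (simp_all add: no_move_def)

lemma with_new_pairs_simps [simp]:
  "paired (with_new_pairs G m s) = paired s \<union> {v \<in> verts G. new_pair (m v)}"
  "contract (with_new_pairs G m s) = contract s"
  "claimed (with_new_pairs G m s) = claimed s"
  "hash_msgs (with_new_pairs G m s) = hash_msgs s"
  "secret_msgs (with_new_pairs G m s) = secret_msgs s"
  by (simp_all add: with_new_pairs_def)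

lemma length_history [simp]: "length (history G \<sigma> t) = Suc t"
  by (induction t) auto

lemma history_nonempty [simp]: "history G \<sigma> t \<noteq> []"
  by (metis Zero_not_Suc length_history list.size(3))

lemma last_view_history: "last (map (view G v) (history G \<sigma> t)) = view G v (state_at G \<sigma> t)"
  by (simp add: last_map state_at_def)

lemma state_at_0 [simp]: "state_at G \<sigma> 0 = init_state"
  by (simp add: state_at_def)

lemma state_at_Suc: "state_at G \<sigma> (Suc t) = step G t (move_at G \<sigma> t) (state_at G \<sigma> t)"
  by (simp add: state_at_def move_at_def[abs_def])

lemma transferred_eq: "transferred G \<sigma> = (\<Union>t. claimed (state_at G \<sigma> t))"
  by (simp add: transferred_def state_at_def)

lemma init_state_simps [simp]:
  "paired init_state = {}" "contract init_state e = None" "claimed init_state = {}"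
  "hash_msgs init_state = {}" "secret_msgs init_state = {}"
  by (simp_all add: init_state_def)

text \<open>Moves depend only on the past, so their agreement may be checked under the hypothesis
  that the histories agree so far, even for different strategies.\<close>

lemma history_cong:
  assumes "\<And>i c. i < t \<Longrightarrow> history G \<sigma> i = history G \<sigma>' i \<Longrightarrow> move_at G \<sigma> i c = move_at G \<sigma>' i c"
  shows "i \<le> t \<Longrightarrow> history G \<sigma> i = history G \<sigma>' i"
proof (induction i)
  case (Suc i)
  then have "history G \<sigma> i = history G \<sigma>' i" "move_at G \<sigma> i = move_at G \<sigma>' i"
    using assms by (auto intro!: ext)
  then show ?case by (simp add: move_at_def[abs_def])
qed simp

section \<open>The effect of one step\<close>

lemma paired_step [simp]: "paired (step G t m s) = paired s \<union> {v \<in> verts G. new_pair (m v)}"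
  by (simp add: step_def Let_def)

lemma contract_step: "contract (step G t m s) e =
  (case contract s e of Some c \<Rightarrow> Some c | None \<Rightarrow>
    (case create (m (tail G e)) e of None \<Rightarrow> None | Some (\<tau>, x) \<Rightarrow>
      if e \<in> arcs G \<and> x \<in> known_hashes G (with_new_pairs G m s) (tail G e)
      then Some (\<tau>, x) else None))"
  by (simp add: step_def Let_def with_new_pairs_def split: option.splits)

lemma contract_step_old: "contract s e = Some c \<Longrightarrow> contract (step G t m s) e = Some c"
  by (simp add: contract_step)

lemma contract_step_new:
  assumes "contract s e = None"
  shows "contract (step G t m s) e = Some (\<tau>, x) \<longleftrightarrow> create (m (tail G e)) e = Some (\<tau>, x) \<and>
    e \<in> arcs G \<and> x \<in> known_hashes G (with_new_pairs G m s) (tail G e)"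
  using assms by (auto simp: contract_step split: option.splits if_splits)

lemma contract_step_None: "contract s e = None \<Longrightarrow> create (m (tail G e)) e = None \<Longrightarrow>
    contract (step G t m s) e = None"
  by (simp add: contract_step)

lemma claimed_step: "claimed (step G t m s) = claimed s \<union>
  {e \<in> arcs G. e \<in> claim (m (head G e)) \<and> (\<exists>\<tau> x. contract s e = Some (\<tau>, x) \<and> t \<le> \<tau> \<and>
     x \<in> known_secrets G (with_new_pairs G m s) (head G e))}"
  by (simp add: step_def Let_def with_new_pairs_def)

lemma hash_msgs_step: "hash_msgs (step G t m s) = hash_msgs s \<union>
  {(v, w, x). v \<in> verts G \<and> w \<in> verts G \<and> (w, x) \<in> send_hash (m v) \<and>
     x \<in> known_hashes G (with_new_pairs G m s) v}"
  by (simp add: step_def Let_def with_new_pairs_def)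

lemma secret_msgs_step: "secret_msgs (step G t m s) = secret_msgs s \<union>
  {(v, w, x). v \<in> verts G \<and> w \<in> verts G \<and> (w, x) \<in> send_secret (m v) \<and>
     x \<in> known_secrets G (with_new_pairs G m s) v}"
  by (simp add: step_def Let_def with_new_pairs_def)

section \<open>Persistence and knowledge along a run\<close>

lemma contract_persists:
  "i \<le> j \<Longrightarrow> contract (state_at G \<sigma> i) e = Some c \<Longrightarrow> contract (state_at G \<sigma> j) e = Some c"
  by (induction j rule: dec_induct) (auto simp: state_at_Suc contract_step_old)

lemma claimed_mono: "i \<le> j \<Longrightarrow> claimed (state_at G \<sigma> i) \<subseteq> claimed (state_at G \<sigma> j)"
  by (induction j rule: dec_induct) (auto simp: state_at_Suc claimed_step)

lemma claimed_contract:
  "e \<in> claimed (state_at G \<sigma> t) \<Longrightarrow> e \<in> arcs G \<and> (\<exists>c. contract (state_at G \<sigma> t) e = Some c)"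
  by (induction t) (auto simp: state_at_Suc claimed_step dest: contract_step_old)

text \<open>Recovers from a claimed asset the step of its claim, and with it the deadline that was
  met and the secret that was known.\<close>

lemma ex_claim_step:
  "e \<in> claimed (state_at G \<sigma> t) \<Longrightarrow> \<exists>i<t. e \<notin> claimed (state_at G \<sigma> i) \<and>
     e \<in> claimed (state_at G \<sigma> (Suc i)) \<and> e \<in> arcs G \<and> e \<in> claim (move_at G \<sigma> i (head G e)) \<and>
     (\<exists>\<tau> x. contract (state_at G \<sigma> i) e = Some (\<tau>, x) \<and> i \<le> \<tau> \<and>
        x \<in> known_secrets G (with_new_pairs G (move_at G \<sigma> i) (state_at G \<sigma> i)) (head G e))"
proof (induction t)
  case (Suc t)
  show ?case
  proof (cases "e \<in> claimed (state_at G \<sigma> t)")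
    case True
    show ?thesis using Suc.IH[OF True] less_SucI by blast
  next
    case False
    then show ?thesis using Suc.prems
      by (intro exI[of _ t]) (auto simp: state_at_Suc claimed_step)
  qed
qed simp

lemma known_secrets_iff: "x \<in> known_secrets G s v \<longleftrightarrow> (x = v \<and> v \<in> paired s) \<or>
   (\<exists>e \<tau>. e \<in> arcs G \<and> tail G e = v \<and> e \<in> claimed s \<and> contract s e = Some (\<tau>, x)) \<or>
   (\<exists>u. (u, v, x) \<in> secret_msgs s)"
  by (auto simp: known_secrets_def)

lemma known_hashes_iff: "x \<in> known_hashes G s v \<longleftrightarrow> x \<in> known_secrets G s v \<or>
   (\<exists>e \<tau>. e \<in> arcs G \<and> head G e = v \<and> contract s e = Some (\<tau>, x)) \<or>
   (\<exists>u. (u, v, x) \<in> hash_msgs s)"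
  by (auto simp: known_hashes_def)

text \<open>Symbolic hashlocks cannot be invented: whatever circulates originates from a pair that
  its owner has created. So the owner of a hashlock in use is a party that knows the secret.\<close>

lemma locks_paired:
  "paired (state_at G \<sigma> t) \<subseteq> verts G \<and>
   (\<forall>e \<tau> x. contract (state_at G \<sigma> t) e = Some (\<tau>, x) \<longrightarrow> e \<in> arcs G \<and> x \<in> paired (state_at G \<sigma> t)) \<and>
   (\<forall>u v x. (u, v, x) \<in> hash_msgs (state_at G \<sigma> t) \<longrightarrow> x \<in> paired (state_at G \<sigma> t)) \<and>
   (\<forall>u v x. (u, v, x) \<in> secret_msgs (state_at G \<sigma> t) \<longrightarrow> x \<in> paired (state_at G \<sigma> t))"
proof (induction t)
  case (Suc t)
  let ?s = "state_at G \<sigma> t" and ?m = "move_at G \<sigma> t"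
  have known: "x \<in> paired (step G t ?m ?s)" if "x \<in> known_hashes G (with_new_pairs G ?m ?s) v" for x v
    using that Suc by (auto simp: known_hashes_iff known_secrets_iff)
  then have known': "x \<in> paired (step G t ?m ?s)" if "x \<in> known_secrets G (with_new_pairs G ?m ?s) v" for x v
    using that known_hashes_iff by metis
  have "e \<in> arcs G \<and> x \<in> paired (step G t ?m ?s)" if "contract (step G t ?m ?s) e = Some (\<tau>, x)" for e \<tau> x
  proof (cases "contract ?s e")
    case None
    then show ?thesis using that known by (auto simp: contract_step_new)
  next
    case (Some c)
    then show ?thesis using that Suc contract_step_old[OF Some, of G t ?m] by auto
  qed
  moreover have "paired ?s \<subseteq> paired (step G t ?m ?s)" by auto
  moreover have "paired (step G t ?m ?s) \<subseteq> verts G" using Suc by auto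
  ultimately show ?case
    using Suc known known' unfolding state_at_Suc
    by (intro conjI) (auto simp: hash_msgs_step secret_msgs_step simp del: paired_step)
qed simp

section \<open>Outcomes of single parties and of coalitions\<close>

context digraph
begin

lemma incoming_singleton: "incoming G {v} = {e \<in> arcs G. head G e = v}"
  using no_loops by (auto simp: incoming_def)

lemma outgoing_singleton: "outgoing G {v} = {e \<in> arcs G. tail G e = v}"
  using no_loops by (force simp: outgoing_def)

lemma acceptable_iff: "acceptable G {v} (outcome G \<sigma> {v}) \<longleftrightarrow>
   (\<forall>e\<in>arcs G. head G e = v \<longrightarrow> e \<in> transferred G \<sigma>) \<or>
   (\<forall>e\<in>arcs G. tail G e = v \<longrightarrow> e \<notin> transferred G \<sigma>)"
  by (auto simp: acceptable_def outcome_def incoming_singleton outgoing_singleton)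

lemma live_iff: "live G P \<longleftrightarrow> arcs G \<subseteq> transferred G P"
proof -
  have "live G P \<longleftrightarrow> (\<forall>v\<in>verts G. \<forall>e\<in>arcs G. head G e = v \<or> tail G e = v \<longrightarrow> e \<in> transferred G P)"
    by (auto simp: live_def outcome_def deal_def incoming_singleton outgoing_singleton)
  then show ?thesis by auto
qed

text \<open>Once FreeRide and Discount are excluded, an outcome other than Deal is NoDeal or
  Underwater. Either way it lies below Deal, so by antisymmetry it cannot be preferred to
  Deal.\<close>

lemma safe_imp_strong_nash:
  assumes sc: "strongly_connected G" and "safe G P" "live G P"
    and pref: "\<And>C. C \<subseteq> verts G \<Longrightarrow> C \<noteq> {} \<Longrightarrow> preference_relation G C (pref C)"
  shows "strong_nash G pref P"
  unfolding strong_nash_def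
proof (intro allI impI notI)
  fix C \<sigma>
  let ?w = "outcome G \<sigma> C"
  assume C: "C \<subseteq> verts G \<and> C \<noteq> {} \<and> (\<forall>v\<in>verts G - C. \<sigma> v = P v)"
    and better: "?w \<noteq> outcome G P C \<and> (outcome G P C, ?w) \<in> pref C"
  have deal: "outcome G P C = deal G C"
    using \<open>live G P\<close> by (auto simp: live_iff outcome_def deal_def incoming_def outgoing_def)
  define L where "L = {v \<in> verts G - C. \<exists>e\<in>arcs G. tail G e = v \<and> e \<in> transferred G \<sigma>}"
  have L: "e \<in> transferred G \<sigma>" if "head G e \<in> L" "e \<in> arcs G" for e
    using that \<open>safe G P\<close> C unfolding safe_def L_def acceptable_iff by blast
  have L_intro: "tail G e \<in> L" if "e \<in> arcs G" "e \<in> transferred G \<sigma>" "tail G e \<notin> C" for e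
    using that by (auto simp: L_def)
  obtain c where c: "c \<in> C" "c \<in> verts G" using C by blast
  have no_free_ride: "\<not> free_ride ?w"
  proof
    assume "free_ride ?w"
    then obtain e where e: "e \<in> incoming G C" "e \<in> transferred G \<sigma>"
      and out: "outgoing G C \<inter> transferred G \<sigma> = {}"
      by (auto simp: free_ride_def outcome_def)
    have e_L: "tail G e \<in> L" using e L_intro by (auto simp: incoming_def)
    \<comment> \<open>Losses propagate backwards along this path. Reaching the coalition would
      require a transferred arc that leaves it, so all of the path, including \<open>c\<close>,
      would lie in \<open>L\<close>.\<close>
    have "c \<rightarrow>\<^sup>*\<^bsub>G\<^esub> tail G e" using sc c e by (auto simp: incoming_def)
    then have "c \<in> L"
    proof (induction rule: converse_reachable_induct)
      case (step x y)
      then obtain g where g: "g \<in> arcs G" "tail G g = x" "head G g = y" by auto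
      then have "g \<in> transferred G \<sigma>" using L step by blast
      moreover have "y \<notin> C" using step by (simp add: L_def)
      ultimately show ?case using g out L_intro by (auto simp: outgoing_def)
    qed (rule e_L)
    then show False using c by (simp add: L_def)
  qed
  have no_discount: "\<not> discount G C ?w"
  proof
    assume "discount G C ?w"
    then have inc: "incoming G C \<subseteq> transferred G \<sigma>"
      and out: "\<not> outgoing G C \<subseteq> transferred G \<sigma>"
      by (auto simp: discount_def outcome_def)
    \<comment> \<open>Here the propagation starts from the acquired incoming assets of the coalition
      and reaches every honest party.\<close>
    have "v \<in> C \<or> v \<in> L" if "v \<in> verts G" for v
    proof -
      have "v \<rightarrow>\<^sup>*\<^bsub>G\<^esub> c" using sc c that by auto
      then show ?thesis
      proof (induction rule: converse_reachable_induct)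
        case (step x y)
        then obtain g where g: "g \<in> arcs G" "tail G g = x" "head G g = y" by auto
        then have "x \<in> C \<or> g \<in> transferred G \<sigma>" using L step inc by (auto simp: incoming_def)
        then show ?case using g L_intro by auto
      qed (simp add: c)
    qed
    then have "outgoing G C \<subseteq> transferred G \<sigma>" using L head_in_verts by (fastforce simp: outgoing_def)
    then show False using out by simp
  qed
  have R: "preference_relation G C (pref C)" using pref C by blast
  have w: "?w \<in> outcomes G C" by (auto simp: outcomes_def outcome_def)
  have "trans (pref C)" "antisym (pref C)"
    using R by (auto simp: preference_relation_def partial_order_on_def preorder_on_def)
  moreover have "(?w, no_deal) \<in> pref C \<or> ?w = no_deal"
    using R w no_free_ride no_discount better deal
    by (auto simp: preference_relation_def underwater_def)
  moreover have "(no_deal, deal G C) \<in> pref C" using R by (auto simp: preference_relation_def)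
  ultimately show False using better deal by (metis antisymD transD)
qed

end

section \<open>Every live and safe protocol yields a lock schedule\<close>

locale live_safe_protocol = digraph G
  for G :: "('a, 'b) pre_digraph" +
  fixes P :: "'a \<Rightarrow> ('a, 'b) strategy"
  assumes strong: "strongly_connected G"
    and htlc: "htlc_based G P"
    and live: "live G P"
    and safe: "safe G P"
begin

lemma safeD:
  assumes "e \<in> arcs G" "e \<in> transferred G \<sigma>" "\<sigma> (tail G e) = P (tail G e)"
    and "f \<in> arcs G" "head G f = tail G e"
  shows "f \<in> transferred G \<sigma>"
proof -
  have "acceptable G {tail G e} (outcome G \<sigma> {tail G e})"
    using safe assms(1,3) by (simp add: safe_def)
  then show ?thesis using assms unfolding acceptable_iff by blast
qed

lemma no_secret_msgs: "secret_msgs (state_at G P t) = {}"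
proof (induction t)
  case (Suc t)
  have "send_secret (move_at G P t v) = {}" if "v \<in> verts G" for v
    using htlc that by (simp add: htlc_based_def move_at_def)
  then show ?case using Suc by (auto simp: state_at_Suc secret_msgs_step)
qed simp

text \<open>If the contract on \<open>f = (z, w)\<close> were still missing at the first claim, consider two runs in
  which the first claim takes place as usual. In the first one \<open>w\<close> falls silent
  afterwards; safety of all other parties then propagates backwards up to \<open>w\<close>, so \<open>w\<close> loses an asset. In
  the second one \<open>w\<close> is honest, while all others replay the first run except that \<open>z\<close> never
  creates \<open>f\<close>; so \<open>w\<close> loses the same asset but does not acquire \<open>f\<close>.\<close>

lemma contracts_precede_first_claim:
  assumes none: "claimed (state_at G P T) = {}" and first: "claimed (state_at G P (Suc T)) \<noteq> {}"
    and f: "f \<in> arcs G"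
  shows "contract (state_at G P T) f \<noteq> None"
proof
  assume f_None: "contract (state_at G P T) f = None"
  define w where "w = head G f"
  have w: "w \<in> verts G" "tail G f \<noteq> w" using f no_loops by (auto simp: w_def)
  \<comment> \<open>The history at time \<open>t\<close> has length \<open>Suc t\<close>; so
    \<open>w\<close> still follows \<open>P\<close> at time \<open>T\<close>, and the first claim
    takes place.\<close>
  define \<sigma> where "\<sigma> = P(w := (\<lambda>h. if length h \<le> Suc T then P w h else no_move))"
  let ?r = "state_at G \<sigma>"
  have hist: "history G \<sigma> i = history G P i" if "i \<le> Suc T" for i
    by (rule history_cong[OF _ that]) (auto simp: \<sigma>_def move_at_def)
  then have r_eq: "?r i = state_at G P i" if "i \<le> Suc T" for i
    using that by (simp add: state_at_def)
  have silent: "move_at G \<sigma> i w = no_move" if "i > T" for i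
    using that by (simp add: move_at_def \<sigma>_def)
  obtain e where "e \<in> claimed (?r (Suc T))" using first r_eq by auto
  then have e: "e \<in> arcs G" "e \<in> transferred G \<sigma>"
    using claimed_contract by (fastforce simp: transferred_eq)+
  have "\<exists>g\<in>arcs G. tail G g = w \<and> g \<in> transferred G \<sigma>"
  proof (rule ccontr)
    assume no_loss: "\<not> ?thesis"
    have "w \<rightarrow>\<^sup>*\<^bsub>G\<^esub> tail G e" using strong w e by auto
    then have "\<exists>g\<in>arcs G. tail G g = w \<and> g \<in> transferred G \<sigma>"
    proof (induction rule: converse_reachable_induct)
      case base
      then show ?case using e by blast
    next
      case (step x y)
      then obtain h g where h: "h \<in> arcs G" "tail G h = x" "head G h = y"
        and g: "g \<in> arcs G" "tail G g = y" "g \<in> transferred G \<sigma>" by auto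
      then have "\<sigma> y = P y" using no_loss by (auto simp: \<sigma>_def)
      then have "h \<in> transferred G \<sigma>" using safeD[of g \<sigma> h] g h by simp
      then show ?case using h by blast
    qed
    then show False using no_loss by blast
  qed
  then obtain g n where g: "g \<in> arcs G" "tail G g = w" "g \<in> claimed (?r n)"
    by (auto simp: transferred_eq)

  \<comment> \<open>Each party attempts all its actions recorded so far in the first run, except for
    \<open>f\<close>; repeated or impossible actions have no effect. No knowledge of the strategies
    behind the first run is required.\<close>
  define replay where "replay c s = \<lparr>new_pair = c \<in> paired s, create = (contract s)(f := None),
    claim = claimed s, send_hash = {(u, x). (c, u, x) \<in> hash_msgs s},
    send_secret = {(u, x). (c, u, x) \<in> secret_msgs s}\<rparr>" for c and s :: "('a, 'b) state"
  \<comment> \<open>Step \<open>T\<close> is treated separately because the contract on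
    \<open>f\<close> might be created in that very step. Afterwards step \<open>i\<close> copies the
    state after step \<open>i\<close>, hence the index \<open>Suc i\<close>.\<close>
  define script where "script c i =
    (if i < T then move_at G P i c
     else if i = T then (move_at G P T c)\<lparr>create := (create (move_at G P T c))(f := None)\<rparr>
     else replay c (?r (Suc i)))" for c i
  define \<rho> where "\<rho> = (\<lambda>c. if c = w then P w else (\<lambda>h. script c (length h - 1)))"
  let ?q = "state_at G \<rho>"
  have \<rho>_move: "move_at G \<rho> i c = script c i" if "c \<noteq> w" for i c
    using that by (simp add: move_at_def \<rho>_def)
  have hist_\<rho>: "history G \<rho> i = history G P i" if "i \<le> T" for i
  proof (rule history_cong[OF _ that])
    fix i c assume i: "i < T" "history G \<rho> i = history G P i"
    show "move_at G \<rho> i c = move_at G P i c"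
    proof (cases "c = w")
      case True
      then show ?thesis using i by (simp add: move_at_def \<rho>_def)
    next
      case False
      then show ?thesis using i by (simp add: \<rho>_move script_def)
    qed
  qed
  have \<rho>_w: "move_at G \<rho> T w = move_at G P T w" using hist_\<rho> by (simp add: move_at_def \<rho>_def)
  have q_T: "?q T = state_at G P T" using hist_\<rho> by (simp add: state_at_def)

  \<comment> \<open>The second run contains the first one except for \<open>f\<close>. Contracts not
    created by \<open>w\<close> must agree exactly, since a contract can be created only once and a
    deviating one would block its copy; an honest \<open>w\<close> may add further
    contracts.\<close>
  have inv: "paired (?r i) \<subseteq> paired (?q i) \<and> claimed (?r i) \<subseteq> claimed (?q i) \<and>
     hash_msgs (?r i) \<subseteq> hash_msgs (?q i) \<and> secret_msgs (?r i) \<subseteq> secret_msgs (?q i) \<and>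
     (\<forall>e c. e \<noteq> f \<longrightarrow> contract (?r i) e = Some c \<longrightarrow> contract (?q i) e = Some c) \<and>
     (\<forall>e. e \<noteq> f \<longrightarrow> tail G e \<noteq> w \<longrightarrow> contract (?q i) e = contract (?r i) e) \<and>
     f \<notin> claimed (?r i) \<and> contract (?q i) f = None" if "Suc T \<le> i" for i
    using that
  proof (induction i rule: dec_induct)
    case base
    let ?s = "state_at G P T" and ?m = "move_at G P T" and ?m' = "move_at G \<rho> T"
    have m': "new_pair (?m' c) = new_pair (?m c)" "claim (?m' c) = claim (?m c)"
      "send_hash (?m' c) = send_hash (?m c)" "send_secret (?m' c) = send_secret (?m c)"
      "e \<noteq> f \<Longrightarrow> create (?m' c) e = create (?m c) e" for c e
      using \<rho>_w \<rho>_move[of c T] by (cases "c = w"; simp add: script_def)+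
    have pairs: "with_new_pairs G ?m' ?s = with_new_pairs G ?m ?s"
      by (simp add: with_new_pairs_def m')
    have r': "?r (Suc T) = step G T ?m ?s" using r_eq[of "Suc T"] by (simp add: state_at_Suc)
    have q': "?q (Suc T) = step G T ?m' ?s" using q_T by (simp add: state_at_Suc)
    have "contract (?q (Suc T)) e = contract (?r (Suc T)) e" if "e \<noteq> f" for e
      using that by (simp add: r' q' contract_step pairs m' cong: option.case_cong)
    moreover have "contract (?q (Suc T)) f = None"
      unfolding q' using f_None \<rho>_move[of "tail G f" T] w by (intro contract_step_None) (auto simp: script_def)
    moreover have "f \<notin> claimed (?r (Suc T))" using none f_None by (simp add: r' claimed_step)
    ultimately show ?case
      by (simp add: r' q' claimed_step hash_msgs_step secret_msgs_step pairs m')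
  next
    case (step i)
    let ?m = "move_at G \<sigma> i" and ?m' = "move_at G \<rho> i"
    let ?r1 = "with_new_pairs G ?m (?r i)" and ?q1 = "with_new_pairs G ?m' (?q i)"
    note IH = step.IH
    have mw: "?m w = no_move" using silent step.hyps by simp
    have m': "?m' c = replay c (?r (Suc i))" if "c \<noteq> w" for c
      using \<rho>_move[OF that] step.hyps by (simp add: script_def)
    have r': "?r (Suc i) = step G i ?m (?r i)" and q': "?q (Suc i) = step G i ?m' (?q i)"
      by (simp_all add: state_at_Suc)
    have pair: "paired ?r1 \<subseteq> paired ?q1"
    proof
      fix v assume "v \<in> paired ?r1"
      then consider "v \<in> paired (?r i)" | "v \<in> verts G" "new_pair (?m v)" by auto
      then show "v \<in> paired ?q1"
      proof cases
        case 2
        then have "v \<noteq> w" "v \<in> paired (?r (Suc i))" using mw by (auto simp: r')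
        then show ?thesis using 2 m' by (simp add: replay_def)
      qed (use IH in auto)
    qed
    have sec: "x \<in> known_secrets G ?q1 c" if known: "x \<in> known_secrets G ?r1 c" for x c
    proof -
      consider "x = c" "c \<in> paired ?r1" | e \<tau> where "e \<in> arcs G" "tail G e = c" "e \<in> claimed (?r i)"
        "contract (?r i) e = Some (\<tau>, x)" | u where "(u, c, x) \<in> secret_msgs (?r i)"
        using known by (auto simp: known_secrets_iff)
      then show ?thesis
      proof cases
        case 1 then show ?thesis using pair by (auto simp: known_secrets_iff)
      next
        case 2
        then have "e \<in> claimed (?q i)" "contract (?q i) e = Some (\<tau>, x)" using IH by auto
        then show ?thesis using 2 by (auto simp: known_secrets_iff)
      next
        case 3 then show ?thesis using IH by (auto simp: known_secrets_iff)
      qed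
    qed
    have hash: "x \<in> known_hashes G ?q1 c" if known: "x \<in> known_hashes G ?r1 c" "c \<noteq> w" for x c
    proof -
      consider "x \<in> known_secrets G ?r1 c" | e \<tau> where "e \<in> arcs G" "head G e = c"
        "contract (?r i) e = Some (\<tau>, x)" | u where "(u, c, x) \<in> hash_msgs (?r i)"
        using known by (auto simp: known_hashes_iff)
      then show ?thesis
      proof cases
        case 1 then show ?thesis using sec by (auto simp: known_hashes_iff)
      next
        case 2
        then have "e \<noteq> f" using known w_def by auto
        then have "contract (?q i) e = Some (\<tau>, x)" using IH 2 by auto
        then show ?thesis using 2 by (auto simp: known_hashes_iff)
      next
        case 3 then show ?thesis using IH by (auto simp: known_hashes_iff)
      qed
    qed
    have contr: "contract (?q (Suc i)) e = Some (\<tau>, x)"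
      if "e \<noteq> f" "contract (?r (Suc i)) e = Some (\<tau>, x)" for e \<tau> x
    proof (cases "contract (?r i) e")
      case (Some c)
      then have "contract (?r (Suc i)) e = Some c" by (simp add: r' contract_step_old)
      then show ?thesis using Some IH that unfolding q' by (metis contract_step_old)
    next
      case None
      then have new: "create (?m (tail G e)) e = Some (\<tau>, x)" "e \<in> arcs G"
        "x \<in> known_hashes G ?r1 (tail G e)"
        using that(2) unfolding r' contract_step_new[OF None] by auto
      then have tw: "tail G e \<noteq> w" using mw by auto
      then have "contract (?q i) e = None" using IH that(1) None by auto
      moreover have "create (?m' (tail G e)) e = Some (\<tau>, x)"
        using m'[OF tw] that by (simp add: replay_def)
      ultimately show ?thesis unfolding q' using new hash tw by (simp add: contract_step_new)
    qed
    have contr': "contract (?q (Suc i)) e = contract (?r (Suc i)) e" if "e \<noteq> f" "tail G e \<noteq> w" for e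
    proof (cases "contract (?r (Suc i)) e")
      case (Some c)
      then show ?thesis using contr that by (cases c) auto
    next
      case None
      then have "contract (?r i) e = None" unfolding r' by (metis contract_step_old not_None_eq)
      then have "contract (?q i) e = None" using IH that by auto
      moreover have "create (?m' (tail G e)) e = None" using m'[OF that(2)] None by (simp add: replay_def)
      ultimately show ?thesis unfolding q' None by (rule contract_step_None)
    qed
    have "contract (?q (Suc i)) f = None"
      unfolding q' using IH m'[OF w(2)] by (intro contract_step_None) (auto simp: replay_def)
    \<comment> \<open>Only \<open>w\<close>, the head of \<open>f\<close>, could claim it, and in
      the first run \<open>w\<close> is silent.\<close>
    moreover have "f \<notin> claimed (?r (Suc i))"
      using IH mw w_def by (auto simp: r' claimed_step)
    moreover have "claimed (?r (Suc i)) \<subseteq> claimed (?q (Suc i))"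
    proof
      fix e assume e': "e \<in> claimed (?r (Suc i))"
      show "e \<in> claimed (?q (Suc i))"
      proof (cases "e \<in> claimed (?r i)")
        case True then show ?thesis using IH by (auto simp: q' claimed_step)
      next
        case False
        then obtain \<tau> x where cl: "e \<in> arcs G" "e \<in> claim (?m (head G e))"
          "contract (?r i) e = Some (\<tau>, x)" "i \<le> \<tau>" "x \<in> known_secrets G ?r1 (head G e)"
          using e' by (auto simp: r' claimed_step)
        then have hw: "head G e \<noteq> w" using mw by auto
        then have "e \<noteq> f" using w_def by auto
        then have "contract (?q i) e = Some (\<tau>, x)" using IH cl by auto
        moreover have "e \<in> claim (?m' (head G e))" using m'[OF hw] e' by (simp add: replay_def)
        ultimately show ?thesis using cl sec by (auto simp: q' claimed_step)
      qed
    qed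
    moreover have "hash_msgs (?r (Suc i)) \<subseteq> hash_msgs (?q (Suc i))"
    proof
      fix y assume y: "y \<in> hash_msgs (?r (Suc i))"
      obtain v u x where [simp]: "y = (v, u, x)" by (cases y)
      show "y \<in> hash_msgs (?q (Suc i))"
      proof (cases "y \<in> hash_msgs (?r i)")
        case True then show ?thesis using IH by (auto simp: q' hash_msgs_step)
      next
        case False
        then have sent: "v \<in> verts G" "u \<in> verts G" "(u, x) \<in> send_hash (?m v)" "x \<in> known_hashes G ?r1 v"
          using y by (auto simp: r' hash_msgs_step)
        then have vw: "v \<noteq> w" using mw by auto
        have "(u, x) \<in> send_hash (?m' v)" using m'[OF vw] y by (simp add: replay_def)
        then show ?thesis using sent hash vw by (simp add: q' hash_msgs_step)
      qed
    qed
    moreover have "secret_msgs (?r (Suc i)) \<subseteq> secret_msgs (?q (Suc i))"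
    proof
      fix y assume y: "y \<in> secret_msgs (?r (Suc i))"
      obtain v u x where [simp]: "y = (v, u, x)" by (cases y)
      show "y \<in> secret_msgs (?q (Suc i))"
      proof (cases "y \<in> secret_msgs (?r i)")
        case True then show ?thesis using IH by (auto simp: q' secret_msgs_step)
      next
        case False
        then have sent: "v \<in> verts G" "u \<in> verts G" "(u, x) \<in> send_secret (?m v)"
          "x \<in> known_secrets G ?r1 v"
          using y by (auto simp: r' secret_msgs_step)
        then have vw: "v \<noteq> w" using mw by auto
        have "(u, x) \<in> send_secret (?m' v)" using m'[OF vw] y by (simp add: replay_def)
        then show ?thesis using sent sec by (simp add: q' secret_msgs_step)
      qed
    qed
    moreover have "paired (?r (Suc i)) \<subseteq> paired (?q (Suc i))" using pair by (simp add: r' q')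
    moreover have "\<forall>e c. e \<noteq> f \<longrightarrow> contract (?r (Suc i)) e = Some c \<longrightarrow> contract (?q (Suc i)) e = Some c"
      using contr by auto
    moreover have "\<forall>e. e \<noteq> f \<longrightarrow> tail G e \<noteq> w \<longrightarrow> contract (?q (Suc i)) e = contract (?r (Suc i)) e"
      using contr' by blast
    ultimately show ?case by blast
  qed
  have "g \<in> claimed (?r (max n (Suc T)))" using g(3) by (meson claimed_mono max.cobounded1 subsetD)
  then have "g \<in> transferred G \<rho>" using inv[of "max n (Suc T)"] by (auto simp: transferred_eq)
  moreover have "\<rho> (tail G g) = P (tail G g)" using g(2) by (simp add: \<rho>_def)
  moreover have "head G f = tail G g" using g(2) w_def by simp
  ultimately have "f \<in> transferred G \<rho>" using safeD g(1) f by blast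
  then obtain j where "f \<in> claimed (?q j)" by (auto simp: transferred_eq)
  then obtain c where "contract (?q j) f = Some c" using claimed_contract by metis
  then have "contract (?q (max j (Suc T))) f = Some c" by (rule contract_persists[rotated]) simp
  then show False using inv[of "max j (Suc T)"] by simp
qed

section \<open>Creation times and protectors in the honest run\<close>

definition creation :: "'b \<Rightarrow> nat" where
  "creation e = (LEAST t. contract (state_at G P (Suc t)) e \<noteq> None)"

definition lock :: "'b \<Rightarrow> 'a" where
  "lock e = snd (the (contract (state_at G P (Suc (creation e))) e))"

definition timeout :: "'b \<Rightarrow> nat" where
  "timeout e = fst (the (contract (state_at G P (Suc (creation e))) e))"

lemma claimed_eventually: "e \<in> arcs G \<Longrightarrow> \<exists>t. e \<in> claimed (state_at G P t)"
  using live by (auto simp: live_iff transferred_eq)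

text \<open>By liveness every asset is claimed, so every contract appears, and it never changes
  afterwards. A contract created in step \<open>creation e\<close> is visible only from the next
  state on, hence the strict inequality.\<close>

lemma contract_honest:
  assumes "e \<in> arcs G"
  shows "contract (state_at G P t) e = (if creation e < t then Some (timeout e, lock e) else None)"
proof -
  obtain n where n: "contract (state_at G P n) e \<noteq> None"
    using claimed_eventually[OF assms] claimed_contract by fastforce
  then obtain n' where "n = Suc n'" by (cases n) auto
  then have ex: "contract (state_at G P (Suc (creation e))) e \<noteq> None"
    using n unfolding creation_def by (metis (mono_tags, lifting) LeastI)
  then have c: "contract (state_at G P (Suc (creation e))) e = Some (timeout e, lock e)"
    by (auto simp: timeout_def lock_def)
  show ?thesis
  proof (cases "creation e < t")
    case True
    then show ?thesis using contract_persists[OF _ c, of t] by simp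
  next
    case False
    show ?thesis
    proof (cases t)
      case (Suc m)
      then have "m < creation e" using False by simp
      then have "contract (state_at G P (Suc m)) e = None"
        unfolding creation_def by (blast dest: not_less_Least)
      then show ?thesis using Suc False by simp
    qed simp
  qed
qed

lemma no_claim_before_creation:
  assumes e: "e \<in> arcs G"
  shows "claimed (state_at G P (creation e)) = {}"
proof -
  define T where "T = (LEAST t. claimed (state_at G P (Suc t)) \<noteq> {})"
  obtain n where n: "claimed (state_at G P n) \<noteq> {}" using claimed_eventually[OF e] by auto
  then obtain n' where "n = Suc n'" by (cases n) auto
  then have T: "claimed (state_at G P (Suc T)) \<noteq> {}"
    using n unfolding T_def by (metis (mono_tags, lifting) LeastI)
  have T0: "claimed (state_at G P T) = {}"
  proof (cases T)
    case (Suc m)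
    then have "m < T" by simp
    then have "claimed (state_at G P (Suc m)) = {}"
      unfolding T_def by (blast dest: not_less_Least)
    then show ?thesis using Suc by simp
  qed simp
  have "creation e < T"
    using contracts_precede_first_claim[OF T0 T e] contract_honest[OF e] by (auto split: if_splits)
  then show ?thesis using T0 claimed_mono[of "creation e" T G P] by simp
qed

text \<open>Both facts are read off from the step that claims \<open>e\<close>: it comes after the
  creation and meets the deadline, and since no secrets are sent, a foreign secret was learned from
  a claimed outgoing contract.\<close>

lemma claim_honest:
  assumes "e \<in> arcs G"
  shows "creation e < timeout e"
    and "lock e \<noteq> head G e \<Longrightarrow> \<exists>f\<in>arcs G. tail G f = head G e \<and> lock f = lock e"
proof -
  obtain i \<tau> x where i: "contract (state_at G P i) e = Some (\<tau>, x)" "i \<le> \<tau>"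
    "x \<in> known_secrets G (with_new_pairs G (move_at G P i) (state_at G P i)) (head G e)"
    using claimed_eventually[OF assms] ex_claim_step by metis
  then have eq: "creation e < i" "\<tau> = timeout e" "x = lock e"
    using contract_honest[OF assms, of i] by (auto split: if_splits)
  then show "creation e < timeout e" using i by simp
  assume "lock e \<noteq> head G e"
  then obtain f \<tau>' where f: "f \<in> arcs G" "tail G f = head G e"
    "contract (state_at G P i) f = Some (\<tau>', lock e)"
    using i(3) no_secret_msgs[of i] unfolding known_secrets_iff eq by auto
  then show "\<exists>f\<in>arcs G. tail G f = head G e \<and> lock f = lock e"
    using contract_honest[OF f(1), of i] by (auto split: if_splits)
qed

text \<open>As soon as \<open>e\<close> is created, all parties except \<open>tail G e\<close> may stop following the protocol, apart from
  claiming \<open>e\<close>. The tail of \<open>e\<close> must then acquire all its incoming assets using only its own secret and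
  that of \<open>lock e\<close>.\<close>

lemma creation_order:
  assumes e: "e \<in> arcs G" and f: "f \<in> arcs G" "head G f = tail G e" and foreign: "lock e \<noteq> tail G e"
  shows "creation f < creation e \<and> lock f \<in> {tail G e, lock e}"
proof -
  define v where "v = tail G e"
  define k where "k = creation e"
  \<comment> \<open>At time \<open>k\<close> the contract on \<open>e\<close> is just being created;
    meanwhile all secrets are sent to its buyer, where \<open>UNIV\<close> has effect only for known
    ones. The claim at \<open>Suc k\<close> is the earliest possible.\<close>
  define script where "script c i = (if i < k then move_at G P i c
     else if i = k then no_move\<lparr>send_secret := {head G e} \<times> UNIV\<rparr>
     else if i = Suc k then no_move\<lparr>claim := {e}\<rparr> else no_move)" for c i
  define \<rho> where "\<rho> = (\<lambda>c. if c = v then P v else (\<lambda>h. script c (length h - 1)))"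
  let ?q = "state_at G \<rho>"
  have hv: "head G e \<noteq> v" "tail G f \<noteq> v" "head G f = v" using e f no_loops[of e] no_loops[of f]
    by (auto simp: v_def)
  have \<rho>_move: "move_at G \<rho> i c = script c i" if "c \<noteq> v" for i c
    using that by (simp add: move_at_def \<rho>_def)
  have hist: "history G \<rho> i = history G P i" if "i \<le> k" for i
  proof (rule history_cong[OF _ that])
    fix i c assume i: "i < k" "history G \<rho> i = history G P i"
    show "move_at G \<rho> i c = move_at G P i c"
    proof (cases "c = v")
      case True
      then show ?thesis using i by (simp add: move_at_def \<rho>_def)
    next
      case False
      then show ?thesis using i by (simp add: \<rho>_move script_def)
    qed
  qed
  have q_k: "?q k = state_at G P k" using hist by (simp add: state_at_def)
  have q_k_claimed: "claimed (?q k) = {}" using no_claim_before_creation[OF e, folded k_def] q_k by simp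
  have m_v: "move_at G \<rho> k v = move_at G P k v" using hist by (simp add: move_at_def \<rho>_def)
  have no_secret: "send_secret (move_at G \<rho> i v) = {}" for i
    using htlc e by (simp add: htlc_based_def move_at_def \<rho>_def v_def)
  have e_None: "contract (state_at G P k) e = None"
    using contract_honest[OF e] by (simp add: k_def)
  have "contract (state_at G P (Suc k)) e = Some (timeout e, lock e)"
    using contract_honest[OF e] by (simp add: k_def)
  then have create: "create (move_at G P k v) e = Some (timeout e, lock e)"
    "lock e \<in> known_hashes G (with_new_pairs G (move_at G P k) (state_at G P k)) v"
    unfolding state_at_Suc contract_step_new[OF e_None] by (auto simp: v_def)
  \<comment> \<open>The pairs created in step \<open>k\<close> give \<open>v\<close> no foreign
    hashlock, so \<open>lock e\<close> was known, and its pair existed, before that step.\<close>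
  have known: "lock e \<in> known_hashes G (state_at G P k) v"
    using create(2) foreign by (auto simp: known_hashes_iff known_secrets_iff v_def)
  then have paired: "lock e \<in> paired (state_at G P k)"
    using locks_paired[of G P k] foreign by (auto simp: known_hashes_iff known_secrets_iff v_def)
  then have lock_verts: "lock e \<in> verts G" using locks_paired[of G P k] by auto
  have e_q: "contract (?q (Suc k)) e = Some (timeout e, lock e)"
    using e_None create(1) known e m_v unfolding state_at_Suc q_k contract_step_new[OF e_None]
    by (auto simp: v_def known_hashes_iff known_secrets_iff)
  have "(lock e, head G e, lock e) \<in> secret_msgs (?q (Suc k))"
    using e lock_verts paired foreign \<rho>_move[of "lock e" k]
    by (auto simp: state_at_Suc secret_msgs_step q_k script_def known_secrets_iff v_def)
  moreover have "Suc k \<le> timeout e" using claim_honest(1)[OF e] by (simp add: k_def)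
  moreover have "e \<in> claim (move_at G \<rho> (Suc k) (head G e))"
    using \<rho>_move[OF hv(1), of "Suc k"] by (simp add: script_def)
  ultimately have "e \<in> claimed (?q (Suc (Suc k)))"
    using e e_q unfolding state_at_Suc[of G \<rho> "Suc k"] claimed_step
    by (auto simp: known_secrets_iff)
  then have "e \<in> transferred G \<rho>" by (auto simp: transferred_eq)
  then have "f \<in> transferred G \<rho>" using safeD[of e \<rho> f] e f by (simp add: \<rho>_def v_def)
  then obtain n where "f \<in> claimed (?q n)" by (auto simp: transferred_eq)
  then obtain i \<tau> x where i: "contract (?q i) f = Some (\<tau>, x)"
    "x \<in> known_secrets G (with_new_pairs G (move_at G \<rho> i) (?q i)) v" "f \<in> claimed (?q (Suc i))"
    using ex_claim_step[of f G \<rho> n] hv(3) by blast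
  \<comment> \<open>From time \<open>k\<close> on, \<open>v\<close> loses at most \<open>e\<close>,
    receives no secrets, and the contract on \<open>f\<close> can no longer be created.\<close>
  have inv: "claimed (?q i) \<inter> {g. tail G g = v} \<subseteq> {e} \<and> (\<forall>u x. (u, v, x) \<notin> secret_msgs (?q i)) \<and>
     contract (?q i) f = contract (state_at G P k) f" if "k \<le> i" for i
    using that
  proof (induction i rule: dec_induct)
    case base
    then show ?case using q_k_claimed no_secret_msgs[of k] q_k by simp
  next
    case (step i)
    have cl: "claim (move_at G \<rho> i c) \<subseteq> {e}" "create (move_at G \<rho> i c) g = None"
      "send_secret (move_at G \<rho> i c) \<subseteq> {head G e} \<times> UNIV" if "c \<noteq> v" for c g
      using \<rho>_move[OF that] step.hyps by (auto simp: script_def)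
    have "claimed (?q (Suc i)) \<inter> {g. tail G g = v} \<subseteq> {e}"
    proof
      fix g assume g: "g \<in> claimed (?q (Suc i)) \<inter> {g. tail G g = v}"
      show "g \<in> {e}"
      proof (cases "g \<in> claimed (?q i)")
        case False
        then have "g \<in> arcs G" "g \<in> claim (move_at G \<rho> i (head G g))"
          using g by (auto simp: state_at_Suc claimed_step)
        then show ?thesis using cl(1)[of "head G g"] g no_loops[of g] by auto
      qed (use step.IH g in auto)
    qed
    moreover have "(u, v, x) \<notin> secret_msgs (?q (Suc i))" for u x
      using step.IH cl(3)[of u] no_secret[of i] hv(1)
      by (cases "u = v") (auto simp: state_at_Suc secret_msgs_step)
    moreover have "contract (?q (Suc i)) f = contract (?q i) f"
      using cl(2)[OF hv(2)] by (auto simp: state_at_Suc contract_step split: option.splits)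
    ultimately show ?case using step.IH by simp
  qed
  have "contract (state_at G P k) f = Some (\<tau>, x)"
  proof (cases "k \<le> i")
    case True then show ?thesis using inv i by simp
  next
    case False
    then have "contract (?q k) f = Some (\<tau>, x)" using i(1) contract_persists[of i k] by simp
    then show ?thesis by (simp add: q_k)
  qed
  then have cf: "creation f < creation e" "lock f = x"
    using contract_honest[OF f(1), of k] by (auto simp: k_def split: if_splits)
  \<comment> \<open>Nothing is claimed up to time \<open>k\<close>, so \<open>f\<close> is claimed
    in the deviating phase.\<close>
  moreover have "k \<le> i"
  proof (rule ccontr)
    assume "\<not> k \<le> i"
    then have "f \<in> claimed (?q k)" using i(3) claimed_mono[of "Suc i" k G \<rho>] by auto
    then show False using q_k_claimed by simp
  qed
  moreover have "x \<in> {v, lock e}"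
  proof -
    have "contract (?q i) e = Some (timeout e, lock e)" if "k < i"
      using that e_q contract_persists[of "Suc k" i] by simp
    then show ?thesis
      using i(2) q_k_claimed inv[OF \<open>k \<le> i\<close>] \<open>k \<le> i\<close> by (cases "k = i") (auto simp: known_secrets_iff)
  qed
  ultimately show ?thesis by (simp add: v_def)
qed

lemma lock_schedule: "lock_schedule G lock creation"
  by unfold_locales (use strong claim_honest(2) creation_order in blast)+

end

section \<open>The protocol of a lock schedule\<close>

context lock_schedule
begin

text \<open>Every planned contract is already visible at this time, and every timeout
  \<open>2 * horizon - k e\<close> lies beyond it.\<close>

definition horizon :: nat where
  "horizon = Suc (Max (insert 0 (k ` arcs G)))"

text \<open>Timeouts decrease in the order of creation, and exceed the time \<open>horizon\<close> at which the root
  triggers the claims.\<close>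

definition lock_contract :: "'b \<Rightarrow> nat \<times> 'a" where
  "lock_contract e = (2 * horizon - k e, lk e)"

definition all_in_placed :: "'a \<Rightarrow> ('a, 'b) state \<Rightarrow> bool" where
  "all_in_placed v s \<longleftrightarrow> (\<forall>e\<in>arcs G. head G e = v \<longrightarrow> contract s e = Some (lock_contract e))"

definition foreign_out_claimed :: "'a \<Rightarrow> ('a, 'b) state \<Rightarrow> bool" where
  "foreign_out_claimed v s \<longleftrightarrow> (\<exists>e\<in>arcs G. tail G e = v \<and> lk e \<noteq> v \<and> e \<in> claimed s)"

text \<open>Only a contract with a foreign hashlock waits for the incoming contracts; one with the
  party's own hashlock is safe as long as the secret is kept. Claiming \<open>UNIV\<close> is
  harmless since impossible claims have no effect. Hashlocks travel in the contracts themselves,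
  hence no messages.\<close>

definition lock_protocol :: "'a \<Rightarrow> 'a \<Rightarrow> ('a, 'b) strategy" where
  "lock_protocol r v h =
     (let t = length h - 1; s = last h in
      \<lparr>new_pair = True,
       create = (\<lambda>e. if e \<in> arcs G \<and> t = k e \<and> (lk e = v \<or> all_in_placed v s)
                     then Some (lock_contract e) else None),
       claim = (if (v = r \<and> t = horizon \<and> all_in_placed v s) \<or> foreign_out_claimed v s
                then UNIV else {}),
       send_hash = {}, send_secret = {}\<rparr>)"

lemma k_less_horizon: "e \<in> arcs G \<Longrightarrow> k e < horizon"
  unfolding horizon_def by (intro le_imp_less_Suc Max_ge) auto

lemma all_in_placed_view: "all_in_placed v (view G v s) \<longleftrightarrow> all_in_placed v s"
  by (auto simp: all_in_placed_def view_def restrict_map_def)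

lemma foreign_out_claimed_view: "foreign_out_claimed v (view G v s) \<longleftrightarrow> foreign_out_claimed v s"
  by (auto simp: foreign_out_claimed_def view_def)

lemma lock_protocol_move:
  assumes "\<sigma> v = lock_protocol r v"
  shows "new_pair (move_at G \<sigma> t v)" "send_secret (move_at G \<sigma> t v) = {}"
    "create (move_at G \<sigma> t v) e = (if e \<in> arcs G \<and> t = k e \<and>
       (lk e = v \<or> all_in_placed v (state_at G \<sigma> t)) then Some (lock_contract e) else None)"
    "claim (move_at G \<sigma> t v) = (if (v = r \<and> t = horizon \<and> all_in_placed v (state_at G \<sigma> t)) \<or>
       foreign_out_claimed v (state_at G \<sigma> t) then UNIV else {})"
  using assms
  by (simp_all add: move_at_def lock_protocol_def Let_def last_view_history all_in_placed_view
      foreign_out_claimed_view)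

lemma htlc_based_lock_protocol: "htlc_based G (lock_protocol r)"
  by (simp add: htlc_based_def lock_protocol_def Let_def)

lemma all_in_placed_persists:
  "i \<le> j \<Longrightarrow> all_in_placed v (state_at G \<sigma> i) \<Longrightarrow> all_in_placed v (state_at G \<sigma> j)"
  unfolding all_in_placed_def by (meson contract_persists)

section \<open>One honest party against arbitrary others\<close>

context
  fixes \<sigma> r v
  assumes honest: "\<sigma> v = lock_protocol r v" and v: "v \<in> verts G"
begin

lemmas honest_move = lock_protocol_move[where \<sigma> = \<sigma> and v = v and r = r, OF honest]

lemma own_contract:
  assumes "e \<in> arcs G" "tail G e = v" "contract (state_at G \<sigma> t) e = Some c"
  shows "c = lock_contract e \<and> (lk e \<noteq> v \<longrightarrow> all_in_placed v (state_at G \<sigma> t))"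
  using assms(3)
proof (induction t)
  case (Suc t)
  show ?case
  proof (cases "contract (state_at G \<sigma> t) e")
    case None
    then have "create (move_at G \<sigma> t v) e = Some c"
      using Suc.prems assms contract_step_new[OF None] by (cases c) (auto simp: state_at_Suc)
    then have "c = lock_contract e" "lk e \<noteq> v \<longrightarrow> all_in_placed v (state_at G \<sigma> t)"
      by (auto simp: honest_move split: if_splits)
    then show ?thesis using all_in_placed_persists[of t "Suc t"] by auto
  next
    case (Some d)
    then have "d = c" using Suc.prems contract_step_old[OF Some] by (simp add: state_at_Suc)
    then show ?thesis using Suc.IH Some all_in_placed_persists[of t "Suc t"] by auto
  qed
qed simp

text \<open>An honest \<open>v\<close> sends no secrets, so its secret first leaves through one of
  its own claims. Any other way of learning it presupposes a party other than \<open>v\<close> that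
  already knows it; hence the induction covers all \<open>u\<close> at once.\<close>

lemma secret_kept:
  assumes "\<forall>e\<in>arcs G. head G e = v \<longrightarrow> e \<notin> claimed (state_at G \<sigma> t)" "u \<noteq> v"
  shows "v \<notin> known_secrets G (state_at G \<sigma> t) u"
  using assms
proof (induction t arbitrary: u)
  case 0
  then show ?case by (simp add: known_secrets_iff)
next
  case (Suc t)
  let ?s = "state_at G \<sigma> t" and ?m = "move_at G \<sigma> t"
  have unclaimed: "\<forall>e\<in>arcs G. head G e = v \<longrightarrow> e \<notin> claimed ?s"
    using Suc.prems(1) claimed_mono[of t "Suc t" G \<sigma>] by auto
  have kept: "v \<notin> known_secrets G (with_new_pairs G ?m ?s) u" if "u \<noteq> v" for u
    using Suc.IH[OF unclaimed that] that by (auto simp: known_secrets_iff)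
  show ?case
  proof
    assume "v \<in> known_secrets G (state_at G \<sigma> (Suc t)) u"
    then consider e \<tau> where "e \<in> arcs G" "tail G e = u" "e \<in> claimed (state_at G \<sigma> (Suc t))"
        "contract (state_at G \<sigma> (Suc t)) e = Some (\<tau>, v)"
      | u' where "(u', u, v) \<in> secret_msgs (state_at G \<sigma> (Suc t))"
      using Suc.prems(2) by (auto simp: known_secrets_iff)
    then show False
    proof cases
      case 1
      have hd: "head G e \<noteq> v" using Suc.prems(1) 1 by blast
      show False
      proof (cases "e \<in> claimed ?s")
        case True
        then obtain c where c: "contract ?s e = Some c" using claimed_contract by metis
        then have "c = (\<tau>, v)" using 1 contract_step_old[OF c] by (simp add: state_at_Suc)
        then have "v \<in> known_secrets G ?s u" using 1 True c by (auto simp: known_secrets_iff)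
        then show False using Suc.IH[OF unclaimed Suc.prems(2)] by blast
      next
        case False
        then obtain \<tau>' x where x: "contract ?s e = Some (\<tau>', x)"
          "x \<in> known_secrets G (with_new_pairs G ?m ?s) (head G e)"
          using 1 by (auto simp: state_at_Suc claimed_step)
        then have "x = v" using 1 contract_step_old[OF x(1)] by (simp add: state_at_Suc)
        then show False using x kept[OF hd] by simp
      qed
    next
      case 2
      then have "(u', u, v) \<in> secret_msgs ?s \<or>
          (u' \<noteq> v \<and> v \<in> known_secrets G (with_new_pairs G ?m ?s) u')"
        using honest_move(2)[of t] by (auto simp: state_at_Suc secret_msgs_step)
      then show False
        using kept[of u'] Suc.IH[OF unclaimed Suc.prems(2)] by (auto simp: known_secrets_iff)
    qed
  qed
qed

text \<open>The common end of both reasons for claiming. The deadline is stated as a sum to avoid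
  truncated subtraction.\<close>

lemma claim_all:
  assumes placed: "all_in_placed v (state_at G \<sigma> t)" and all: "claim (move_at G \<sigma> t v) = UNIV"
    and intime: "\<And>e. e \<in> arcs G \<Longrightarrow> head G e = v \<Longrightarrow> t + k e \<le> 2 * horizon"
    and known: "\<And>e. e \<in> arcs G \<Longrightarrow> head G e = v \<Longrightarrow> lk e \<noteq> v \<Longrightarrow>
      lk e \<in> known_secrets G (with_new_pairs G (move_at G \<sigma> t) (state_at G \<sigma> t)) v"
    and f: "f \<in> arcs G" "head G f = v"
  shows "f \<in> transferred G \<sigma>"
proof -
  have "lk f \<in> known_secrets G (with_new_pairs G (move_at G \<sigma> t) (state_at G \<sigma> t)) v"
    using known[OF f] honest_move(1)[of t] v
    by (cases "lk f = v") (auto simp: known_secrets_iff)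
  moreover have "contract (state_at G \<sigma> t) f = Some (2 * horizon - k f, lk f)"
    using placed f by (simp add: all_in_placed_def lock_contract_def)
  ultimately have "f \<in> claimed (state_at G \<sigma> (Suc t))"
    using f all intime[OF f] by (auto simp: state_at_Suc claimed_step)
  then show ?thesis by (auto simp: transferred_eq)
qed

text \<open>The claim of \<open>e\<close> reveals the only foreign secret that can protect an
  incoming contract. Since these were created earlier, their timeouts are later by at least one
  step, which is the step needed to react.\<close>

lemma foreign_out_claimed_acquires:
  assumes "foreign_out_claimed v (state_at G \<sigma> n)" and f: "f \<in> arcs G" "head G f = v"
  shows "f \<in> transferred G \<sigma>"
proof -
  obtain e where e: "e \<in> arcs G" "tail G e = v" "lk e \<noteq> v" "e \<in> claimed (state_at G \<sigma> n)"
    using assms by (auto simp: foreign_out_claimed_def)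
  then obtain i \<tau> x where i: "e \<in> claimed (state_at G \<sigma> (Suc i))"
    "contract (state_at G \<sigma> i) e = Some (\<tau>, x)" "i \<le> \<tau>"
    using ex_claim_step[of e G \<sigma> n] by blast
  let ?t = "Suc i"
  have c: "(\<tau>, x) = lock_contract e" "all_in_placed v (state_at G \<sigma> i)"
    using own_contract[OF e(1,2) i(2)] e(3) by auto
  have ct: "contract (state_at G \<sigma> ?t) e = Some (\<tau>, x)" using contract_persists[OF _ i(2)] by simp
  show ?thesis
  proof (rule claim_all[OF _ _ _ _ f])
    show "all_in_placed v (state_at G \<sigma> ?t)" using all_in_placed_persists[OF _ c(2)] by simp
    have "foreign_out_claimed v (state_at G \<sigma> ?t)" using e i by (auto simp: foreign_out_claimed_def)
    then show "claim (move_at G \<sigma> ?t v) = UNIV" by (simp add: honest_move(4))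
  next
    fix g assume g: "g \<in> arcs G" "head G g = v"
    then have "k g < k e" using order[of e g] e by simp
    then show "?t + k g \<le> 2 * horizon"
      using i(3) c(1) k_less_horizon[OF e(1)] by (simp add: lock_contract_def)
  next
    fix g assume g: "g \<in> arcs G" "head G g = v" "lk g \<noteq> v"
    then have "lk g = x" using order[of e g] e c(1) by (simp add: lock_contract_def)
    then show "lk g \<in> known_secrets G (with_new_pairs G (move_at G \<sigma> ?t) (state_at G \<sigma> ?t)) v"
      using e i(1) ct by (auto simp: known_secrets_iff)
  qed
qed

lemma root_acquires:
  assumes "v = r" and own: "\<And>e. e \<in> arcs G \<Longrightarrow> head G e = v \<Longrightarrow> lk e = v"
    and placed: "all_in_placed v (state_at G \<sigma> horizon)" and f: "f \<in> arcs G" "head G f = v"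
  shows "f \<in> transferred G \<sigma>"
proof (rule claim_all[OF placed _ _ _ f])
  show "claim (move_at G \<sigma> horizon v) = UNIV"
    unfolding honest_move(4) using placed \<open>v = r\<close> by simp
next
  fix e assume "e \<in> arcs G"
  then show "horizon + k e \<le> 2 * horizon" using k_less_horizon by fastforce
qed (use own in blast)

text \<open>If \<open>e\<close> is protected by \<open>v\<close>, its buyer needed the secret of
  \<open>v\<close>, which leaks only after a claim by \<open>v\<close>. Such a claim is made by the
  root at \<open>horizon\<close> or after a foreign outgoing claim, and in both cases
  \<open>v\<close> acquires everything.\<close>

lemma honest_acceptable:
  assumes tree: "lock_tree r par"
    and e: "e \<in> arcs G" "tail G e = v" "e \<in> transferred G \<sigma>" and f: "f \<in> arcs G" "head G f = v"
  shows "f \<in> transferred G \<sigma>"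
proof -
  obtain n where n: "e \<in> claimed (state_at G \<sigma> n)" using e by (auto simp: transferred_eq)
  show ?thesis
  proof (cases "lk e = v")
    case False
    then show ?thesis using foreign_out_claimed_acquires[OF _ f, of n] e n
      by (auto simp: foreign_out_claimed_def)
  next
    case True
    obtain i \<tau> x where i: "contract (state_at G \<sigma> i) e = Some (\<tau>, x)"
      "x \<in> known_secrets G (with_new_pairs G (move_at G \<sigma> i) (state_at G \<sigma> i)) (head G e)"
      using ex_claim_step[OF n] by blast
    have "x = v" using own_contract[OF e(1,2) i(1)] True by (simp add: lock_contract_def)
    moreover have hv: "head G e \<noteq> v" using no_loops e by metis
    ultimately have "v \<in> known_secrets G (state_at G \<sigma> i) (head G e)"
      using i(2) by (auto simp: known_secrets_iff)
    then obtain g where g: "g \<in> arcs G" "head G g = v" "g \<in> claimed (state_at G \<sigma> i)"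
      using secret_kept hv by blast
    then obtain j where "g \<in> claim (move_at G \<sigma> j v)" using ex_claim_step[OF g(3)] by auto
    then consider "v = r" "j = horizon" "all_in_placed v (state_at G \<sigma> j)"
      | "foreign_out_claimed v (state_at G \<sigma> j)"
      by (auto simp: honest_move split: if_splits)
    then show ?thesis
    proof cases
      case 1
      then show ?thesis using root_acquires[OF _ _ _ f] lock_tree_root(2)[OF tree] by blast
    next
      case 2
      then show ?thesis using foreign_out_claimed_acquires f by blast
    qed
  qed
qed

end

lemma safe_lock_protocol:
  assumes "lock_tree r par"
  shows "safe G (lock_protocol r)"
  unfolding safe_def
proof (intro ballI allI impI)
  fix v \<sigma> assume "v \<in> verts G" "\<sigma> v = lock_protocol r v"
  then show "acceptable G {v} (outcome G \<sigma> {v})"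
    unfolding acceptable_iff using honest_acceptable[of \<sigma> v r par] assms by blast
qed

section \<open>The run in which everybody is honest\<close>

lemma contract_lock_protocol:
  assumes tree: "lock_tree r par" and "e \<in> arcs G"
  shows "contract (state_at G (lock_protocol r) t) e = (if k e < t then Some (lock_contract e) else None)"
  using assms(2)
proof (induction t arbitrary: e)
  case (Suc t)
  let ?s = "state_at G (lock_protocol r) t" and ?m = "move_at G (lock_protocol r) t"
  note create = lock_protocol_move(3)[where \<sigma> = "lock_protocol r" and r = r, OF refl, of t]
  show ?case
  proof (cases "k e < t")
    case True
    then show ?thesis using Suc.IH[OF Suc.prems] by (simp add: state_at_Suc contract_step_old)
  next
    case False
    then have None: "contract ?s e = None" using Suc.IH[OF Suc.prems] by simp
    show ?thesis
    proof (cases "k e = t")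
      case False
      then show ?thesis using None \<open>\<not> k e < t\<close> Suc.prems
        by (simp add: state_at_Suc contract_step create)
    next
      case True
      let ?v = "tail G e"
      have placed: "all_in_placed ?v ?s" if "lk e \<noteq> ?v"
        unfolding all_in_placed_def
      proof (intro ballI impI)
        fix f assume "f \<in> arcs G" "head G f = ?v"
        then show "contract ?s f = Some (lock_contract f)"
          using Suc.IH[of f] order[OF Suc.prems _ _ that] True by simp
      qed
      have "lk e \<in> known_hashes G (with_new_pairs G ?m ?s) ?v"
      proof (cases "lk e = ?v")
        case True
        then show ?thesis using lock_protocol_move(1)[where \<sigma> = "lock_protocol r" and r = r and v = ?v, OF refl, of t] Suc.prems
          by (auto simp: known_hashes_iff known_secrets_iff)
      next
        case False
        then have vr: "?v \<noteq> r" using lock_tree_root(2)[OF tree Suc.prems] by auto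
        have vG: "?v \<in> verts G" using Suc.prems by simp
        \<comment> \<open>The hashlock is read off from an incoming contract: the parent of
          \<open>?v\<close> also protects an arc entering \<open>?v\<close>, and its contract is
          already placed.\<close>
        have "par ?v = lk e" using lock_tree_parent(4)[OF tree vG vr Suc.prems] False by auto
        then obtain f where f: "f \<in> arcs G" "head G f = ?v" "lk f = lk e"
          using lock_tree_parent(2)[OF tree vG vr] by auto
        then have "contract ?s f = Some (lock_contract f)"
          using placed[OF False] by (simp add: all_in_placed_def)
        then show ?thesis using f by (auto simp: known_hashes_iff lock_contract_def)
      qed
      moreover have "create (?m ?v) e = Some (lock_contract e)"
        using placed True Suc.prems by (auto simp: create)
      ultimately show ?thesis
        using None Suc.prems True by (simp add: state_at_Suc contract_step lock_contract_def)
    qed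
  qed
qed simp

text \<open>The claims of the root start a descent through the creation times. An arc entering a
  non-root party is created before an outgoing arc protected by the parent; once the latter is
  transferred, \<open>honest_acceptable\<close> yields the former.\<close>

lemma live_lock_protocol:
  assumes tree: "lock_tree r par"
  shows "live G (lock_protocol r)"
proof -
  let ?P = "lock_protocol r"
  have r: "r \<in> verts G" "\<And>e. e \<in> arcs G \<Longrightarrow> head G e = r \<Longrightarrow> lk e = r"
    using lock_tree_root[OF tree] by auto
  have root: "f \<in> transferred G ?P" if "f \<in> arcs G" "head G f = r" for f
  proof -
    have "all_in_placed r (state_at G ?P horizon)"
      using contract_lock_protocol[OF tree] k_less_horizon by (simp add: all_in_placed_def)
    then show ?thesis using root_acquires[of ?P r r f] that r by simp
  qed
  have "e \<in> transferred G ?P" if "e \<in> arcs G" for e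
    using that
  proof (induction "horizon - k e" arbitrary: e rule: less_induct)
    case less
    show ?case
    proof (cases "head G e = r")
      case False
      then obtain f where f: "f \<in> arcs G" "tail G f = head G e" "lk f = par (head G e)"
        "par (head G e) \<noteq> head G e"
        using lock_tree_parent(1,3)[OF tree head_in_verts[OF less.prems] False] by fastforce
      then have "k e < k f" using order[of f e] less.prems by simp
      then have "f \<in> transferred G ?P" using less.hyps[of f] f(1) k_less_horizon[of f] by simp
      then show ?thesis
        using honest_acceptable[of ?P "head G e" r par f e] tree f less.prems by simp
    qed (use root less.prems in blast)
  qed
  then show ?thesis by (auto simp: live_iff)
qed

end

theorem theorem1:
  fixes G :: "('a, 'b) pre_digraph"
    and pref :: "'a set \<Rightarrow> 'b outcome rel"
  assumes "swap_digraph G"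
    and "\<And>C. C \<subseteq> verts G \<Longrightarrow> C \<noteq> {} \<Longrightarrow> preference_relation G C (pref C)"
  shows "(\<exists>P. htlc_based G P \<and> atomic G pref P) \<longleftrightarrow> reuniclus G"
proof
  interpret digraph G using assms(1) by (simp add: swap_digraph_def)
  have strong: "strongly_connected G" using assms(1) by (simp add: swap_digraph_def)
  {
    assume "\<exists>P. htlc_based G P \<and> atomic G pref P"
    then obtain P where "htlc_based G P" "live G P" "safe G P" by (auto simp: atomic_def)
    then interpret live_safe_protocol G P using strong by unfold_locales
    show "reuniclus G" by (rule lock_schedule.reuniclus[OF lock_schedule])
  next
    assume "reuniclus G"
    then obtain lk k where "lock_schedule G lk k"
      using reuniclus_imp_lock_schedule digraph_axioms by blast
    then interpret lock_schedule G lk k .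
    obtain r par where tree: "lock_tree r par" using ex_lock_tree by blast
    have "strong_nash G pref (lock_protocol r)"
      using safe_imp_strong_nash strong safe_lock_protocol[OF tree] live_lock_protocol[OF tree] assms(2)
      by blast
    then show "\<exists>P. htlc_based G P \<and> atomic G pref P"
      using htlc_based_lock_protocol safe_lock_protocol[OF tree] live_lock_protocol[OF tree]
      unfolding atomic_def by blast
  }
qed

end
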